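(* Let $G$ be a finite directed acyclic graph, let $P=\top(G)$ be its independence poset, and let $n=|P|$. Label each cover relation $(D,U)\lessdot(D',U')$ of $P$ by the unique vertex $g\in V(G)$ with $\mathrm{flip}_g(D,U)=(D',U')$; this is a proper edge coloring of the Hasse diagram of $P$ by colors in $V(G)$. Let $\mathfrak{G}(G)\le S_P$ be the group generated, for each label $g$ that occurs, by the product of the transpositions $((D,U),(D',U'))$ over all Hasse edges labeled $g$. Then: (1) if $G$ is connected (as an undirected graph), $\mathfrak{G}(G)$ contains the alternating group $A_n$ on $P$; (2) if $G$ is not connected, with connected components $G_1,\dots,G_r$, then $\mathfrak{G}(G)$ is isomorphic to the direct product $\mathfrak{G}(G_1)\times\cdots\times\mathfrak{G}(G_r)$.
   Context: Let $G$ be a directed acyclic graph. The $G$-order on $V(G)$ is the partial order with $g_1\geq g_2$ when there is a directed path from $g_1$ to $g_2$. An independent set is a set of vertices no two of which are adjacent. A pair $(D,U)$ of independent sets is orthogonal if there is no edge of $G$ from an element of $D$ to an element of $U$. An orthogonal pair $(D,U)$ is tight if whenever any element of $D$ is increased (removed and replaced by a strictly larger element in the $G$-order), any element of $U$ is decreased (removed and replaced by a strictly smaller element), or a new element is added to $D$ or to $U$, the result is no longer an orthogonal pair of independent sets. $\top(G)$ denotes the set of tight orthogonal pairs. For every independent set $I$ there is a unique $(I,U)\in\top(G)$ and a unique $(D,I)\in\top(G)$. Fix a linear extension $\ell$ of the $G$-order and a linear extension $\ell'$ of its dual. The flip of $(D,U)\in\top(G)$ at $g\in V(G)$, $\mathrm{flip}_g(D,U)$,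 is defined by: if $g\notin D$ and $g\notin U$, it is $(D,U)$; otherwise, keep the elements of $D$ not less than $g$ and the elements of $U$ not greater than $g$ (deleting all other elements), move $g$ to the other set, and then greedily complete $D$ and $U$ to a tight orthogonal pair in the orders $\ell'$ and $\ell$ respectively. Each $\mathrm{flip}_g$ is a well-defined involution of $\top(G)$. The independence poset on $\top(G)$ is the reflexive and transitive closure of the relations $(D,U)\lessdot(D',U')$ whenever there is $g\in U$ with $\mathrm{flip}_g(D,U)=(D',U')$; these relations are exactly its cover relations.
   Formalization: Orthogonal pairs are taken disjoint; in "tight", one or several elements may be replaced by one strictly larger (smaller) new element; a flip refills D only below g and U only above g. Read literally, unique tight pairs per independent set and involutivity of flips fail. *)

theory Defs
  imports "Graph_Theory.Digraph_Component" "HOL-Algebra.Product_Groups"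
    "HOL-Combinatorics.Permutations"
begin

section \<open>The G-order and its linear extensions\<close>

text \<open>A pair \<open>(x, y)\<close> in \<open>G_order G\<close> means \<open>x \<le> y\<close>, i.e. there is a directed path from \<open>y\<close> to \<open>x\<close>:
  arcs point downwards.\<close>

definition G_order :: "('a, 'b) pre_digraph \<Rightarrow> ('a \<times> 'a) set" where
  "G_order G = {(x, y). y \<rightarrow>\<^sup>*\<^bsub>G\<^esub> x}"

definition G_less :: "('a, 'b) pre_digraph \<Rightarrow> 'a \<Rightarrow> 'a \<Rightarrow> bool" where
  "G_less G x y \<longleftrightarrow> (x, y) \<in> G_order G \<and> x \<noteq> y"

text \<open>A linear extension is represented by the list of all elements in increasing order.\<close>

definition linear_extension :: "'a set \<Rightarrow> ('a \<times> 'a) set \<Rightarrow> 'a list \<Rightarrow> bool" where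
  "linear_extension V r xs \<longleftrightarrow>
     distinct xs \<and> set xs = V \<and> sorted_wrt (\<lambda>x y. (y, x) \<notin> r) xs"

text \<open>So \<open>l\<close> lists the vertices from the bottom of the G-order upwards, \<open>l'\<close> from the top
  downwards. They need not be reverses of each other.\<close>

definition linear_extension_pair :: "('a, 'b) pre_digraph \<Rightarrow> 'a list \<Rightarrow> 'a list \<Rightarrow> bool" where
  "linear_extension_pair G l l' \<longleftrightarrow>
     linear_extension (verts G) (G_order G) l \<and> linear_extension (verts G) ((G_order G)\<inverse>) l'"


section \<open>Tight orthogonal pairs\<close>

definition independent :: "('a, 'b) pre_digraph \<Rightarrow> 'a set \<Rightarrow> bool" where
  "independent G I \<longleftrightarrow> I \<subseteq> verts G \<and> (\<forall>x\<in>I. \<forall>y\<in>I. \<not> x \<rightarrow>\<^bsub>G\<^esub> y)"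

text \<open>The two sets of an orthogonal pair are disjoint. This is tacit in the literature and is needed
  there: for a single vertex \<open>g\<close> the tight pairs are \<open>({}, {g})\<close> and \<open>({g}, {})\<close>.\<close>

definition orthogonal :: "('a, 'b) pre_digraph \<Rightarrow> 'a set \<Rightarrow> 'a set \<Rightarrow> bool" where
  "orthogonal G D U \<longleftrightarrow> independent G D \<and> independent G U \<and> D \<inter> U = {} \<and>
     (\<forall>d\<in>D. \<forall>u\<in>U. \<not> d \<rightarrow>\<^bsub>G\<^esub> u)"

text \<open>\<open>increase G D D'\<close>: one or more elements of \<open>D\<close> are removed and replaced by a new element strictly
  larger than each of them. Replacing several elements at once has to be allowed: for the graph with
  arcs \<open>0 \<rightarrow> 2\<close>, \<open>1 \<rightarrow> 2\<close>, \<open>2 \<rightarrow> 3\<close>, \<open>2 \<rightarrow> 4\<close> no single replacement applies to \<open>({3,4}, {0,1})\<close>, and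
  counting it as tight would destroy the uniqueness of the tight pair with a given first component
  (the pair with first component \<open>{3,4}\<close> is \<open>({3,4}, {2})\<close>). Requiring the new element to
  lie outside \<open>D\<close> keeps plain deletions from counting as replacements.\<close>

definition increase :: "('a, 'b) pre_digraph \<Rightarrow> 'a set \<Rightarrow> 'a set \<Rightarrow> bool" where
  "increase G D D' \<longleftrightarrow> (\<exists>S x. S \<noteq> {} \<and> S \<subseteq> D \<and> x \<in> verts G - D \<and> (\<forall>s\<in>S. G_less G s x) \<and>
     D' = insert x (D - S))"

definition decrease :: "('a, 'b) pre_digraph \<Rightarrow> 'a set \<Rightarrow> 'a set \<Rightarrow> bool" where
  "decrease G U U' \<longleftrightarrow> (\<exists>S x. S \<noteq> {} \<and> S \<subseteq> U \<and> x \<in> verts G - U \<and> (\<forall>s\<in>S. G_less G x s) \<and>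
     U' = insert x (U - S))"

definition tight :: "('a, 'b) pre_digraph \<Rightarrow> 'a set \<Rightarrow> 'a set \<Rightarrow> bool" where
  "tight G D U \<longleftrightarrow> orthogonal G D U \<and>
     (\<forall>D'. increase G D D' \<longrightarrow> \<not> orthogonal G D' U) \<and>
     (\<forall>U'. decrease G U U' \<longrightarrow> \<not> orthogonal G D U') \<and>
     (\<forall>x \<in> verts G - D. \<not> orthogonal G (insert x D) U) \<and>
     (\<forall>x \<in> verts G - U. \<not> orthogonal G D (insert x U))"

type_synonym 'a set_pair = "'a set \<times> 'a set"

definition top_pairs :: "('a, 'b) pre_digraph \<Rightarrow> 'a set_pair set" where
  "top_pairs G = {(D, U). tight G D U}"


section \<open>Flips\<close>

fun greedy_D :: "('a, 'b) pre_digraph \<Rightarrow> 'a set \<Rightarrow> 'a set \<Rightarrow> 'a list \<Rightarrow> 'a set" where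
  "greedy_D G U D [] = D"
| "greedy_D G U D (x # xs) =
     greedy_D G U (if orthogonal G (insert x D) U then insert x D else D) xs"

fun greedy_U :: "('a, 'b) pre_digraph \<Rightarrow> 'a set \<Rightarrow> 'a set \<Rightarrow> 'a list \<Rightarrow> 'a set" where
  "greedy_U G D U [] = U"
| "greedy_U G D U (x # xs) =
     greedy_U G D (if orthogonal G D (insert x U) then insert x U else U) xs"

text \<open>The completion refills exactly the two regions that were emptied: below \<open>g\<close> in \<open>D\<close> and above \<open>g\<close>
  in \<open>U\<close>. An arc from a new element of \<open>D\<close> to a new element of \<open>U\<close> would go upwards, so the two fillings
  do not interfere and may be done in either order. Without the restriction the result would not be
  an involution: for the path \<open>0 \<rightarrow> 1 \<rightarrow> 2\<close>, flipping \<open>({}, {0,2})\<close> at \<open>2\<close> must give \<open>({2}, {1})\<close>,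
  whereas scanning all of \<open>l'\<close> for \<open>D\<close> first would put \<open>0\<close> into \<open>D\<close>.\<close>

definition complete_pair ::
  "('a, 'b) pre_digraph \<Rightarrow> 'a list \<Rightarrow> 'a list \<Rightarrow> 'a \<Rightarrow> 'a set_pair \<Rightarrow> 'a set_pair" where
  "complete_pair G l l' g = (\<lambda>(D, U).
     let D' = greedy_D G U D (filter (\<lambda>x. G_less G x g) l');
         U' = greedy_U G D' U (filter (\<lambda>x. G_less G g x) l)
     in (D', U'))"

definition flip ::
  "('a, 'b) pre_digraph \<Rightarrow> 'a list \<Rightarrow> 'a list \<Rightarrow> 'a \<Rightarrow> 'a set_pair \<Rightarrow> 'a set_pair" where
  "flip G l l' g = (\<lambda>(D, U).
     let K = {x \<in> D. \<not> G_less G x g}; L = {x \<in> U. \<not> G_less G g x} in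
     if g \<in> D then complete_pair G l l' g (K - {g}, insert g L)
     else if g \<in> U then complete_pair G l l' g (insert g K, L - {g})
     else (D, U))"


section \<open>The independence poset and its labelled Hasse diagram\<close>

definition flip_step ::
  "('a, 'b) pre_digraph \<Rightarrow> 'a list \<Rightarrow> 'a list \<Rightarrow> ('a set_pair \<times> 'a set_pair) set" where
  "flip_step G l l' =
     {(p, q). p \<in> top_pairs G \<and> q \<in> top_pairs G \<and> (\<exists>g \<in> snd p. flip G l l' g p = q)}"

definition indep_poset ::
  "('a, 'b) pre_digraph \<Rightarrow> 'a list \<Rightarrow> 'a list \<Rightarrow> ('a set_pair \<times> 'a set_pair) set" where
  "indep_poset G l l' = (flip_step G l l')\<^sup>* \<inter> top_pairs G \<times> top_pairs G"

definition covers :: "('c \<times> 'c) set \<Rightarrow> 'c \<Rightarrow> 'c \<Rightarrow> bool" where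
  "covers r p q \<longleftrightarrow> (p, q) \<in> r \<and> p \<noteq> q \<and>
     \<not> (\<exists>z. (p, z) \<in> r \<and> (z, q) \<in> r \<and> z \<noteq> p \<and> z \<noteq> q)"

definition hasse_edges ::
  "('a, 'b) pre_digraph \<Rightarrow> 'a list \<Rightarrow> 'a list \<Rightarrow> 'a \<Rightarrow> ('a set_pair \<times> 'a set_pair) set" where
  "hasse_edges G l l' g = {(p, q). covers (indep_poset G l l') p q \<and> flip G l l' g p = q}"


section \<open>The group generated by the labels\<close>

text \<open>These generalise \<open>sym_group\<close> and \<open>alt_group\<close> from \<open>{1..n}\<close> to an arbitrary set.\<close>

definition sym_group_on :: "'c set \<Rightarrow> ('c \<Rightarrow> 'c) monoid" where
  "sym_group_on P = \<lparr>carrier = {\<sigma>. \<sigma> permutes P}, mult = (\<circ>), one = id\<rparr>"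

definition alternating_on :: "'c set \<Rightarrow> ('c \<Rightarrow> 'c) set" where
  "alternating_on P = {\<sigma>. \<sigma> permutes P \<and> evenperm \<sigma>}"

definition transposition_product :: "('c \<times> 'c) list \<Rightarrow> 'c \<Rightarrow> 'c" where
  "transposition_product es = foldr (\<lambda>(p, q) \<sigma>. Transposition.transpose p q \<circ> \<sigma>) es id"

text \<open>Edges with the same label are pairwise disjoint, so their transpositions commute and the
  product does not depend on the enumeration \<open>es\<close>; each label contributes one generator.\<close>

definition label_perms ::
  "('a, 'b) pre_digraph \<Rightarrow> 'a list \<Rightarrow> 'a list \<Rightarrow> ('a set_pair \<Rightarrow> 'a set_pair) set" where
  "label_perms G l l' = {transposition_product es | g es.
     g \<in> verts G \<and> hasse_edges G l l' g \<noteq> {} \<and> distinct es \<and> set es = hasse_edges G l l' g}"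

definition flip_group ::
  "('a, 'b) pre_digraph \<Rightarrow> 'a list \<Rightarrow> 'a list \<Rightarrow> ('a set_pair \<Rightarrow> 'a set_pair) monoid" where
  "flip_group G l l' = subgroup_generated (sym_group_on (top_pairs G)) (label_perms G l l')"


section \<open>Connected components of the underlying undirected graph\<close>

text \<open>The library's \<open>connected\<close> refers to the underlying symmetric graph and excludes the empty graph.\<close>

definition components :: "('a, 'b) pre_digraph \<Rightarrow> ('a, 'b) pre_digraph set" where
  "components G = {H. pre_digraph.max_subgraph G Digraph_Component.connected H}"

end

theory Submission
  imports Defs
begin

text \<open>Flips only rearrange the first component at or below \<open>g\<close> and the second one at or above \<open>g\<close>, and
  this determines them. In a chain of upward flips a maximal label enters the first component and
  a minimal label leaves the second one, each for good; hence every flip is a cover and the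
  generators are the flips themselves.

  For connected graphs, induct on the number of vertices, deleting a source \<open>g\<close> (up to duality) that
  leaves the graph connected. The pairs without \<open>g\<close> in the first component correspond to the
  tight pairs of the smaller graph, where every 3-cycle is available; the flip at a vertex \<open>x\<close> with
  \<open>g \<rightarrow> x\<close> is trivial on the remaining pairs, so a commutator of it with a lifted 3-cycle is a 3-cycle
  on all pairs. These 3-cycles and their conjugates under the flip at \<open>g\<close> connect all pairs, hence
  generate the alternating group. For disconnected graphs, tight pairs and flips decompose
  coordinatewise.\<close>

section \<open>Tight pairs and flips of an acyclic relation\<close>

text \<open>The obstacle is the greedy flip: its result is produced by two scans, from which neither
  invertibility nor compatibility with deleting vertices can be read off. It is therefore replaced
  by the relation \<open>up_flip\<close>, which records only what a flip preserves. Since the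
  preserved data determine a tight pair, the relation is functional in both directions.
  Involutivity, duality and passage to subgraphs are then checked on preserved data, and the linear
  extensions disappear; hence each component may carry arbitrary extensions of its own.

  Reversing all arcs and swapping the two sets is a symmetry of the whole setup. It turns sinks into
  sources and halves most arguments.

  Generation by 3-cycles is organised by an equivalence: two points are related if some 3-cycle of
  the group moves both, and once all points are related, all 3-cycles are present. Graphs with two
  vertices need a computation of their own, because the commutator requires a pair that the flip at
  \<open>x\<close> leaves alone.\<close>

lemma kernel_exists:
  assumes "finite W" "finite E" "acyclic E"
  shows "\<exists>K\<subseteq>W. (\<forall>x\<in>K. \<forall>y\<in>K. (x, y) \<notin> E) \<and> (\<forall>x\<in>W - K. \<exists>k\<in>K. (x, k) \<in> E)"
  using assms(1)
proof (induction W rule: finite_psubset_induct)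
  case (psubset W)
  show ?case
  proof (cases "W = {}")
    case False
    \<comment> \<open>\<open>s\<close> has no predecessor in \<open>W\<close>, so a kernel of the
      rest survives whatever is decided about \<open>s\<close>: it joins exactly when no arc leads
      from it into that kernel.\<close>
    obtain s where s: "s \<in> W" "\<And>x. (x, s) \<in> E \<Longrightarrow> x \<notin> W"
      using finite_acyclic_wf[OF assms(2,3)] False wf_eq_minimal by (metis ex_in_conv)
    obtain K where K: "K \<subseteq> W - {s}" "\<forall>x\<in>K. \<forall>y\<in>K. (x, y) \<notin> E"
      "\<forall>x\<in>W - {s} - K. \<exists>k\<in>K. (x, k) \<in> E"
      using psubset.IH[of "W - {s}"] s(1) by blast
    show ?thesis
    proof (cases "\<exists>k\<in>K. (s, k) \<in> E")
      case True
      then show ?thesis using K by (intro exI[of _ K]) blast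
    next
      case False
      moreover have "(s, s) \<notin> E" using s by blast
      ultimately show ?thesis using K s by (intro exI[of _ "insert s K"]) blast
    qed
  qed auto
qed

text \<open>A tight pair colours the vertices by \<open>D\<close>, \<open>U\<close> or neither, and tightness amounts to a local
  condition at each uncoloured vertex; see \<open>top_pairs_eq\<close> below.\<close>

definition tpairs :: "('a \<times> 'a) set \<Rightarrow> 'a set \<Rightarrow> 'a set_pair set" where
  "tpairs E V = {(D, U). D \<subseteq> V \<and> U \<subseteq> V \<and> D \<inter> U = {} \<and>
     (\<forall>x\<in>D. \<forall>y\<in>D. (x, y) \<notin> E) \<and> (\<forall>x\<in>U. \<forall>y\<in>U. (x, y) \<notin> E) \<and> (\<forall>x\<in>D. \<forall>y\<in>U. (x, y) \<notin> E) \<and>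
     (\<forall>x\<in>V. x \<in> D \<or> x \<in> U \<or> (\<exists>d\<in>D. (d, x) \<in> E) \<or> (\<exists>u\<in>U. (x, u) \<in> E))}"

lemma tpairs_iff: "p \<in> tpairs E V \<longleftrightarrow> fst p \<subseteq> V \<and> snd p \<subseteq> V \<and> fst p \<inter> snd p = {} \<and>
     (\<forall>x\<in>fst p. \<forall>y\<in>fst p. (x, y) \<notin> E) \<and> (\<forall>x\<in>snd p. \<forall>y\<in>snd p. (x, y) \<notin> E) \<and>
     (\<forall>x\<in>fst p. \<forall>y\<in>snd p. (x, y) \<notin> E) \<and>
     (\<forall>x\<in>V. x \<in> fst p \<or> x \<in> snd p \<or> (\<exists>d\<in>fst p. (d, x) \<in> E) \<or> (\<exists>u\<in>snd p. (x, u) \<in> E))"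
  by (simp add: tpairs_def case_prod_beta)
text \<open>Allows \<open>E\<close> to stay fixed while \<open>V\<close> is replaced by a subset, as
  happens for vertex deletion and for components.\<close>

lemma tpairs_Restr: "tpairs (Restr E V) V = tpairs E V"
proof -
  have "p \<in> tpairs (Restr E V) V \<longleftrightarrow> p \<in> tpairs E V" for p
    unfolding tpairs_iff by (intro conj_cong refl ball_cong) blast+
  then show ?thesis by auto
qed
lemma finite_tpairs: "finite V \<Longrightarrow> finite (tpairs E V)"
  by (rule finite_subset[of _ "Pow V \<times> Pow V"]) (auto simp: tpairs_iff)
lemma swap_tpairs [simp]: "prod.swap p \<in> tpairs (E\<inverse>) V \<longleftrightarrow> p \<in> tpairs E V"
  unfolding tpairs_iff fst_swap snd_swap converse_iff by blast
lemma tpairs_disjoint: "p \<in> tpairs E V \<Longrightarrow> x \<in> fst p \<Longrightarrow> x \<notin> snd p"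
  unfolding tpairs_iff by auto

lemma tpairs_subset: "p \<in> tpairs E V \<Longrightarrow> fst p \<subseteq> V \<and> snd p \<subseteq> V"
  unfolding tpairs_iff by auto

lemma tpairs_no_edge:
  assumes "p \<in> tpairs E V" "x \<in> fst p \<or> x \<in> snd p" "y \<in> fst p \<or> y \<in> snd p" "(x, y) \<in> E"
  shows "x \<in> snd p \<and> y \<in> fst p"
  using assms unfolding tpairs_iff by blast

lemma tpairs_cover:
  assumes "p \<in> tpairs E V" "x \<in> V" "x \<notin> fst p" "x \<notin> snd p"
  obtains d where "d \<in> fst p" "(d, x) \<in> E" | u where "u \<in> snd p" "(x, u) \<in> E"
  using assms unfolding tpairs_iff by blast

text \<open>Arcs point downwards, so \<open>(g, x) \<in> E\<^sup>*\<close> means that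
  \<open>x\<close> is at or below \<open>g\<close>. The flip is given by the data it keeps; the
  greedy refilling is left implicit and will be forced by tightness of \<open>q\<close>.\<close>

definition up_flip :: "('a \<times> 'a) set \<Rightarrow> 'a \<Rightarrow> 'a set_pair \<Rightarrow> 'a set_pair \<Rightarrow> bool" where
  "up_flip E g p q \<longleftrightarrow> g \<in> snd p \<and> g \<in> fst q \<and>
     (\<forall>x. (g, x) \<notin> E\<^sup>* \<longrightarrow> (x \<in> fst p \<longleftrightarrow> x \<in> fst q)) \<and>
     (\<forall>x. (x, g) \<notin> E\<^sup>* \<longrightarrow> (x \<in> snd p \<longleftrightarrow> x \<in> snd q))"

text \<open>Duality. The order is turned upside down, so an upward flip becomes a downward one and
  \<open>p\<close> and \<open>q\<close> trade places.\<close>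

lemma swap_up_flip [simp]: "up_flip (E\<inverse>) g (prod.swap p) (prod.swap q) \<longleftrightarrow> up_flip E g q p"
  unfolding up_flip_def rtrancl_converse fst_swap snd_swap converse_iff by blast

locale dag =
  fixes E :: "('a \<times> 'a) set"
  assumes finite_E: "finite E" and acyclic_E: "acyclic E"
begin

lemma dag_converse: "dag (E\<inverse>)"
  using finite_E acyclic_E by unfold_locales (auto simp: acyclic_converse)

lemma dag_Restr: "dag (Restr E V)"
  using finite_E acyclic_E by unfold_locales (auto intro: acyclic_subset)

lemma wf_E: "wf E" and wf_converse_E: "wf (E\<inverse>)"
  using finite_acyclic_wf finite_acyclic_wf_converse finite_E acyclic_E by auto

lemma trancl_irrefl: "(x, x) \<notin> E\<^sup>+"
  using acyclic_E by (auto simp: acyclic_def)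

lemma trancl_asym: "(x, y) \<in> E\<^sup>+ \<Longrightarrow> (y, x) \<notin> E\<^sup>*"
  using trancl_irrefl by (meson trancl_rtrancl_trancl)

lemma rtrancl_antisym: "(x, y) \<in> E\<^sup>* \<Longrightarrow> (y, x) \<in> E\<^sup>* \<Longrightarrow> x = y"
  using trancl_asym by (metis rtranclD)

text \<open>Below \<open>g\<close> the first component is forced from the top down. A vertex
  \<open>x\<close> there is left out of it only because of a larger \<open>d\<close> in the first
  component, or because \<open>x\<close> itself or a smaller \<open>u\<close> lies in the second.
  The vertex \<open>d\<close> is settled by induction; \<open>x\<close> and \<open>u\<close>, lying
  below \<open>g\<close>, by the hypothesis on second components. So the same obstruction is present
  in the other pair.\<close>

lemma tpairs_fst_agree:
  assumes p: "p \<in> tpairs E V" and q: "q \<in> tpairs E V"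
    and D: "\<And>x. (g, x) \<notin> E\<^sup>+ \<Longrightarrow> x \<in> fst p \<longleftrightarrow> x \<in> fst q"
    and U: "\<And>x. (x, g) \<notin> E\<^sup>+ \<Longrightarrow> x \<in> snd p \<longleftrightarrow> x \<in> snd q"
  shows "fst p = fst q"
proof -
  have "x \<in> fst p \<longleftrightarrow> x \<in> fst q" for x
    using wf_E
  proof (induction x)
    case (less x)
    show ?case
    proof (cases "(g, x) \<in> E\<^sup>+")
      case True
      have "x \<in> fst q"
        if p: "p \<in> tpairs E V" and q: "q \<in> tpairs E V" and x: "x \<in> fst p"
          and IH: "\<And>d. (d, x) \<in> E \<Longrightarrow> d \<in> fst p \<longleftrightarrow> d \<in> fst q"
          and U: "\<And>x. (x, g) \<notin> E\<^sup>+ \<Longrightarrow> x \<in> snd p \<longleftrightarrow> x \<in> snd q" for p q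
      proof (rule ccontr)
        assume xq: "x \<notin> fst q"
        have xq': "x \<notin> snd q"
          using U[of x] True trancl_asym tpairs_disjoint[OF p x] by (meson trancl_into_rtrancl)
        have "x \<in> V" using tpairs_subset[OF p] x by auto
        then show False
        proof (cases rule: tpairs_cover[OF q _ xq xq', consumes 1])
          case (1 d)
          then show False using IH[of d] tpairs_no_edge[OF p, of d x] tpairs_disjoint[OF p, of d] x by blast
        next
          case (2 u)
          then have "(g, u) \<in> E\<^sup>+" using True by auto
          then have "u \<in> snd p" using U[of u] 2 trancl_asym trancl_into_rtrancl by metis
          then show False using tpairs_no_edge[OF p, of x u] tpairs_disjoint[OF p x] x 2 by blast
        qed
      qed
      from this[OF p q] this[OF q p] show ?thesis using less U by auto
    qed (use D in auto)
  qed
  then show ?thesis by auto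
qed

text \<open>The two hypotheses are exchanged by duality, so \<open>tpairs_fst_agree\<close> in the
  converse relation settles the second components. This is the uniqueness of the greedy
  completion.\<close>

lemma tpairs_eqI:
  assumes p: "p \<in> tpairs E V" and q: "q \<in> tpairs E V"
    and D: "\<And>x. (g, x) \<notin> E\<^sup>+ \<Longrightarrow> x \<in> fst p \<longleftrightarrow> x \<in> fst q"
    and U: "\<And>x. (x, g) \<notin> E\<^sup>+ \<Longrightarrow> x \<in> snd p \<longleftrightarrow> x \<in> snd q"
  shows "p = q"
proof (rule prod_eqI)
  show "fst p = fst q" using assms by (rule tpairs_fst_agree)
  interpret conv: dag "E\<inverse>" by (rule dag_converse)
  have "fst (prod.swap p) = fst (prod.swap q)"
    by (rule conv.tpairs_fst_agree[where g = g and V = V]) (use assms in \<open>auto simp: trancl_converse\<close>)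
  then show "snd p = snd q" by simp
qed

text \<open>Agreement with \<open>p\<close> covers everything outside the open regions below and
  above \<open>g\<close> except \<open>g\<close> itself, and there both targets have
  \<open>g\<close> in the first component.\<close>

lemma up_flip_unique:
  assumes "q \<in> tpairs E V" "q' \<in> tpairs E V" "up_flip E g p q" "up_flip E g p q'"
  shows "q = q'"
proof (rule tpairs_eqI[OF assms(1,2), of g])
  fix x
  show "x \<in> fst q \<longleftrightarrow> x \<in> fst q'" if "(g, x) \<notin> E\<^sup>+"
    using that assms(3,4) unfolding up_flip_def by (metis rtranclD)
  show "x \<in> snd q \<longleftrightarrow> x \<in> snd q'" if "(x, g) \<notin> E\<^sup>+"
    using that assms unfolding up_flip_def by (metis rtranclD tpairs_disjoint)
qed

lemma up_flip_unique':
  assumes "q \<in> tpairs E V" "q' \<in> tpairs E V" "up_flip E g q p" "up_flip E g q' p"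
  shows "q = q'"
proof -
  interpret conv: dag "E\<inverse>" by (rule dag_converse)
  have "prod.swap q = prod.swap q'"
    by (rule conv.up_flip_unique[where g = g and V = V and p = "prod.swap p"]) (use assms in auto)
  then show ?thesis by (metis swap_swap)
qed

text \<open>The two greedy scans become two kernels, one for the freed region \<open>B\<close> below
  \<open>g\<close> and one for the freed region \<open>A\<close> above it. An arc from
  \<open>B\<close> to \<open>A\<close> would close a cycle through \<open>g\<close>, so the two
  choices are independent.\<close>

lemma up_flip_exists:
  assumes V: "finite V" and p: "p \<in> tpairs E V" and g: "g \<in> snd p"
  shows "\<exists>q\<in>tpairs E V. up_flip E g p q"
proof -
  obtain D U where DU: "p = (D, U)" by fastforce
  have gV: "g \<in> V" and gD: "g \<notin> D"
    using tpairs_subset[OF p] tpairs_disjoint[OF p] g DU by auto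
  have DV: "D \<subseteq> V" "U \<subseteq> V" using tpairs_subset[OF p] DU by auto
  note no_edge = tpairs_no_edge[OF p, unfolded DU fst_conv snd_conv]
  have disj: "D \<inter> U = {}" using tpairs_disjoint[OF p] DU by auto
  define B where "B = {x\<in>V. (g, x) \<in> E\<^sup>+}"
  define A where "A = {x\<in>V. (x, g) \<in> E\<^sup>+}"
  have gg: "(g, g) \<notin> E" using trancl_irrefl by blast
  have gAB: "g \<notin> A" "g \<notin> B" using trancl_irrefl by (auto simp: A_def B_def)
  have AB: "A \<inter> B = {}" using trancl_asym trancl_into_rtrancl unfolding A_def B_def by fast
  have down: "y \<in> B" if "x \<in> B \<or> x = g" "(x, y) \<in> E" "y \<in> V" for x y
    using that by (auto simp: B_def)
  have up: "x \<in> A" if "y \<in> A \<or> y = g" "(x, y) \<in> E" "x \<in> V" for x y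
    using that by (auto simp: A_def)
  have BA: "(x, y) \<notin> E" if "x \<in> B" "y \<in> A" for x y
    using that trancl_irrefl by (auto simp: A_def B_def) (meson trancl.trancl_into_trancl trancl_trans)
  define K where "K = insert g (D - B)"
  define L where "L = U - A - {g}"
  have KB: "K \<inter> B = {}" and LA: "L \<inter> A = {}" using gAB by (auto simp: K_def L_def)
  \<comment> \<open>The vertices of \<open>B\<close> that the kept sets \<open>K\<close> and
    \<open>L\<close> do not block: exactly these still compete for the first component.\<close>
  define W where "W = {x\<in>B. x \<notin> U \<and> (\<forall>u\<in>L. (x, u) \<notin> E) \<and> (\<forall>d\<in>K. (d, x) \<notin> E)}"
  define W' where "W' = {x\<in>A. x \<notin> D \<and> (\<forall>d\<in>K. (d, x) \<notin> E) \<and> (\<forall>u\<in>L. (x, u) \<notin> E)}"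
  have finW: "finite W" "finite W'" using V by (auto simp: W_def W'_def A_def B_def)
  \<comment> \<open>A vertex not chosen must have a predecessor in \<open>D1\<close>, so this kernel
    is taken in the converse relation; for \<open>U1\<close> a successor is wanted.\<close>
  obtain D1 where D1: "D1 \<subseteq> W" "\<forall>x\<in>D1. \<forall>y\<in>D1. (x, y) \<notin> E" "\<forall>x\<in>W - D1. \<exists>k\<in>D1. (k, x) \<in> E"
    using kernel_exists[OF finW(1), of "E\<inverse>"] dag_converse unfolding dag_def converse_iff by blast
  obtain U1 where U1: "U1 \<subseteq> W'" "\<forall>x\<in>U1. \<forall>y\<in>U1. (x, y) \<notin> E" "\<forall>x\<in>W' - U1. \<exists>k\<in>U1. (x, k) \<in> E"
    using kernel_exists[OF finW(2) finite_E acyclic_E] by blast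
  have sub: "K \<union> D1 \<subseteq> V" "L \<union> U1 \<subseteq> V"
    using DV gV D1(1) U1(1) by (auto simp: K_def L_def W_def W'_def A_def B_def)
  have disj': "(K \<union> D1) \<inter> (L \<union> U1) = {}"
  proof -
    have "K \<inter> L = {}" "K \<inter> U1 = {}" "D1 \<inter> L = {}" "D1 \<inter> U1 = {}"
      using disj gAB D1(1) U1(1) AB by (auto simp: K_def L_def W_def W'_def)
    then show ?thesis by blast
  qed
  have indD: "(x, y) \<notin> E" if "x \<in> K \<union> D1" "y \<in> K \<union> D1" for x y
  proof
    assume e: "(x, y) \<in> E"
    have "x \<in> K"
    proof (rule ccontr)
      assume "x \<notin> K"
      then have "x \<in> D1" "y \<in> B" using that D1(1) e down[of x y] sub by (auto simp: W_def)
      then show False using KB that D1(2) e by blast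
    qed
    moreover have "y \<in> K" using \<open>x \<in> K\<close> that D1(1) e by (auto simp: W_def)
    ultimately show False
      using e no_edge[of x y] disj gg g DU gD down[of g y] DV by (auto simp: K_def)
  qed
  have indU: "(x, y) \<notin> E" if "x \<in> L \<union> U1" "y \<in> L \<union> U1" for x y
  proof
    assume e: "(x, y) \<in> E"
    have "y \<in> L"
    proof (rule ccontr)
      assume "y \<notin> L"
      then have "y \<in> U1" "x \<in> A" using that U1(1) e up[of y x] sub by (auto simp: W'_def)
      then show False using LA that U1(2) e by blast
    qed
    moreover have "x \<in> L" using \<open>y \<in> L\<close> that U1(1) e by (auto simp: W'_def)
    ultimately show False
      using e no_edge[of x y] disj by (auto simp: L_def)
  qed
  have indDU: "(x, y) \<notin> E" if "x \<in> K \<union> D1" "y \<in> L \<union> U1" for x y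
  proof
    assume e: "(x, y) \<in> E"
    have "y \<in> L"
      using that e U1(1) D1(1) BA[of x y] by (auto simp: W_def W'_def)
    moreover have "x \<in> K" using \<open>y \<in> L\<close> that D1(1) e by (auto simp: W_def)
    ultimately show False
      using e no_edge[of x y] disj g DU by (auto simp: L_def K_def)
  qed
  have cover: "x \<in> K \<union> D1 \<or> x \<in> L \<union> U1 \<or> (\<exists>d\<in>K \<union> D1. (d, x) \<in> E) \<or> (\<exists>u\<in>L \<union> U1. (x, u) \<in> E)"
    if x: "x \<in> V" for x
  proof -
    consider "x = g" | "x \<in> B" | "x \<in> A" | "x \<notin> A" "x \<notin> B" "x \<noteq> g" by blast
    then show ?thesis
    proof cases
      case 1
      then show ?thesis by (simp add: K_def)
    next
      case 2
      show ?thesis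
      proof (cases "x \<in> W")
        case True
        then show ?thesis using D1(3) by blast
      next
        case False
        moreover have "x \<notin> A" "x \<noteq> g" using 2 AB gAB by auto
        ultimately show ?thesis using 2 unfolding W_def by (auto simp: L_def)
      qed
    next
      case 3
      show ?thesis
      proof (cases "x \<in> W'")
        case True
        then show ?thesis using U1(3) by blast
      next
        case False
        moreover have "x \<notin> B" using 3 AB by auto
        ultimately show ?thesis using 3 unfolding W'_def by (auto simp: K_def)
      qed
    next
      \<comment> \<open>Outside both regions the old witness survives: a discarded one would lie in
        \<open>B\<close>, in \<open>A\<close> or at \<open>g\<close>, and its arc to or from
        \<open>x\<close> would put \<open>x\<close> into \<open>B\<close> or
        \<open>A\<close>.\<close>
      case 4
      show ?thesis
      proof (cases "x \<in> D \<or> x \<in> U")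
        case True
        then show ?thesis using 4 by (auto simp: K_def L_def)
      next
        case False
        then consider d where "d \<in> D" "(d, x) \<in> E" | u where "u \<in> U" "(x, u) \<in> E"
          using tpairs_cover[OF p x] DU by auto
        then show ?thesis
        proof cases
          case 1
          then show ?thesis using 4 down[of d x] x by (auto simp: K_def)
        next
          case 2
          then show ?thesis using 4 up[of u x] x by (auto simp: L_def)
        qed
      qed
    qed
  qed
  have "(K \<union> D1, L \<union> U1) \<in> tpairs E V"
    unfolding tpairs_def mem_Collect_eq prod.case
    using sub disj' indD indU indDU cover by blast
  moreover have "x \<in> K \<union> D1 \<longleftrightarrow> x \<in> D" if "(g, x) \<notin> E\<^sup>*" for x
  proof -
    have "x \<noteq> g" "x \<notin> B" using that by (auto simp: B_def dest: trancl_into_rtrancl)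
    then show ?thesis using D1(1) by (auto simp: K_def W_def)
  qed
  moreover have "x \<in> L \<union> U1 \<longleftrightarrow> x \<in> U" if "(x, g) \<notin> E\<^sup>*" for x
  proof -
    have "x \<noteq> g" "x \<notin> A" using that by (auto simp: A_def dest: trancl_into_rtrancl)
    then show ?thesis using U1(1) by (auto simp: L_def W'_def)
  qed
  moreover have "g \<in> K" by (simp add: K_def)
  ultimately show ?thesis using g DU
    by (intro bexI[of _ "(K \<union> D1, L \<union> U1)"]) (simp_all add: up_flip_def)
qed

lemma up_flip_exists':
  assumes "finite V" "p \<in> tpairs E V" "g \<in> fst p"
  shows "\<exists>q\<in>tpairs E V. up_flip E g q p"
proof -
  interpret conv: dag "E\<inverse>" by (rule dag_converse)
  obtain q where "q \<in> tpairs (E\<inverse>) V" "up_flip (E\<inverse>) g (prod.swap p) q"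
    using conv.up_flip_exists[of V "prod.swap p" g] assms by auto
  then show ?thesis
    using swap_tpairs[of "prod.swap q" E V] swap_up_flip[of E g p "prod.swap q"]
    by (intro bexI[of _ "prod.swap q"]) simp_all
qed

text \<open>The second set is a kernel of the vertices outside \<open>X\<close> that no arc from
  \<open>X\<close> enters. Later uses take singletons or the empty set for \<open>X\<close>, to
  exhibit pairs with a prescribed behaviour under flips.\<close>

lemma tpairs_fst_exists:
  assumes "finite V" "X \<subseteq> V" "\<And>x y. x \<in> X \<Longrightarrow> y \<in> X \<Longrightarrow> (x, y) \<notin> E"
  shows "\<exists>p\<in>tpairs E V. fst p = X"
proof -
  define W where "W = {x\<in>V - X. \<forall>d\<in>X. (d, x) \<notin> E}"
  have "finite W" using assms(1) by (auto simp: W_def)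
  from kernel_exists[OF this finite_E acyclic_E] obtain K where K: "K \<subseteq> W" "\<forall>x\<in>K. \<forall>y\<in>K. (x, y) \<notin> E" "\<forall>x\<in>W - K. \<exists>k\<in>K. (x, k) \<in> E"
    by blast
  have "(X, K) \<in> tpairs E V"
    unfolding tpairs_def mem_Collect_eq prod.case
  proof (intro conjI ballI)
    fix x assume "x \<in> V"
    then show "x \<in> X \<or> x \<in> K \<or> (\<exists>d\<in>X. (d, x) \<in> E) \<or> (\<exists>u\<in>K. (x, u) \<in> E)"
      using K(3) by (cases "x \<in> W") (auto simp: W_def)
  qed (use assms K in \<open>auto simp: W_def\<close>)
  then show ?thesis by force
qed

lemma tpairs_snd_exists:
  assumes "finite V" "X \<subseteq> V" "\<And>x y. x \<in> X \<Longrightarrow> y \<in> X \<Longrightarrow> (x, y) \<notin> E"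
  shows "\<exists>p\<in>tpairs E V. snd p = X"
proof -
  interpret conv: dag "E\<inverse>" by (rule dag_converse)
  obtain p where "p \<in> tpairs (E\<inverse>) V" "fst p = X"
    using conv.tpairs_fst_exists[OF assms(1,2)] assms(3) by auto
  then show ?thesis
    using swap_tpairs[of "prod.swap p" E V] by (intro bexI[of _ "prod.swap p"]) auto
qed

end

section \<open>Flips as involutions of the set of tight pairs\<close>

definition flip_related :: "('a \<times> 'a) set \<Rightarrow> 'a set \<Rightarrow> 'a \<Rightarrow> 'a set_pair \<Rightarrow> 'a set_pair \<Rightarrow> bool" where
  "flip_related E V g p q \<longleftrightarrow>
     p \<in> tpairs E V \<and> q \<in> tpairs E V \<and> (up_flip E g p q \<or> up_flip E g q p)"

text \<open>The default \<open>p\<close> serves two cases at once: tight pairs with \<open>g\<close>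
  in neither set, and arguments that are not tight pairs. The latter is what \<open>permutes\<close>
  asks for.\<close>

definition flip_perm :: "('a \<times> 'a) set \<Rightarrow> 'a set \<Rightarrow> 'a \<Rightarrow> 'a set_pair \<Rightarrow> 'a set_pair" where
  "flip_perm E V g p = (if \<exists>q. flip_related E V g p q then THE q. flip_related E V g p q else p)"

lemma flip_related_sym: "flip_related E V g p q \<Longrightarrow> flip_related E V g q p"
  by (auto simp: flip_related_def)

lemma flip_related_converse:
  "flip_related (E\<inverse>) V g (prod.swap p) (prod.swap q) \<longleftrightarrow> flip_related E V g p q"
  by (auto simp: flip_related_def)

context dag
begin

text \<open>A pair cannot be the lower end of one flip at \<open>g\<close> and the upper end of
  another, since \<open>g\<close> would lie in both its sets. So the two flips go the same way and
  one-sided uniqueness applies.\<close>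

lemma flip_related_unique:
  assumes "flip_related E V g p q" "flip_related E V g p q'"
  shows "q = q'"
proof -
  have mem: "p \<in> tpairs E V" "q \<in> tpairs E V" "q' \<in> tpairs E V"
    using assms by (simp_all add: flip_related_def)
  have "\<not> (up_flip E g p r \<and> up_flip E g r' p)" for r r'
    using tpairs_disjoint[OF mem(1), of g] unfolding up_flip_def by blast
  then consider "up_flip E g p q" "up_flip E g p q'" | "up_flip E g q p" "up_flip E g q' p"
    using assms unfolding flip_related_def by blast
  then show ?thesis
    using up_flip_unique[OF mem(2,3)] up_flip_unique'[OF mem(2,3)] by cases
qed

lemma flip_perm_eqI: "flip_related E V g p q \<Longrightarrow> flip_perm E V g p = q"
  unfolding flip_perm_def using flip_related_unique by (metis the_equality)

lemma flip_perm_fixed: "g \<notin> fst p \<Longrightarrow> g \<notin> snd p \<Longrightarrow> flip_perm E V g p = p"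
  by (simp add: flip_perm_def flip_related_def up_flip_def)

lemma flip_perm_outside: "p \<notin> tpairs E V \<Longrightarrow> flip_perm E V g p = p"
  unfolding flip_perm_def flip_related_def by auto

lemma flip_perm_related:
  assumes "finite V" "p \<in> tpairs E V" "g \<in> fst p \<or> g \<in> snd p"
  shows "flip_related E V g p (flip_perm E V g p)"
proof -
  obtain q where "flip_related E V g p q"
    using up_flip_exists up_flip_exists' assms unfolding flip_related_def by metis
  then show ?thesis using flip_perm_eqI by metis
qed

lemma flip_perm_cases:
  assumes "finite V" "p \<in> tpairs E V"
  obtains "flip_related E V g p (flip_perm E V g p)"
  | "g \<notin> fst p" "g \<notin> snd p" "flip_perm E V g p = p"
  using flip_perm_related flip_perm_fixed assms by metis

text \<open>Immediate because \<open>flip_related\<close> is symmetric and functional.\<close>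

lemma flip_perm_involution: "flip_perm E V g (flip_perm E V g p) = p"
proof (cases "\<exists>q. flip_related E V g p q")
  case True
  then show ?thesis using flip_perm_eqI flip_related_sym by metis
next
  case False
  then have "flip_perm E V g p = p" by (simp add: flip_perm_def)
  then show ?thesis by simp
qed

lemma flip_perm_in:
  assumes "p \<in> tpairs E V"
  shows "flip_perm E V g p \<in> tpairs E V"
proof (cases "\<exists>q. flip_related E V g p q")
  case True
  then obtain q where q: "flip_related E V g p q" by auto
  then show ?thesis using flip_perm_eqI[OF q] by (simp add: flip_related_def)
qed (use assms in \<open>simp add: flip_perm_def\<close>)

lemma flip_perm_neq:
  assumes "flip_related E V g p q"
  shows "q \<noteq> p"
proof
  assume "q = p"
  then have "p \<in> tpairs E V" "g \<in> snd p" "g \<in> fst p"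
    using assms unfolding flip_related_def up_flip_def by blast+
  then show False using tpairs_disjoint[of p E V g] by blast
qed

lemma flip_perm_permutes: "flip_perm E V g permutes tpairs E V"
proof -
  have "\<exists>!x. flip_perm E V g x = y" for y
    by (rule ex1I[of _ "flip_perm E V g y"]) (use flip_perm_involution[of V g] in auto)
  then show ?thesis by (simp add: permutes_def flip_perm_outside)
qed

lemma flip_perm_converse: "flip_perm (E\<inverse>) V g = prod.swap \<circ> flip_perm E V g \<circ> prod.swap"
proof
  fix p
  interpret conv: dag "E\<inverse>" by (rule dag_converse)
  show "flip_perm (E\<inverse>) V g p = (prod.swap \<circ> flip_perm E V g \<circ> prod.swap) p"
  proof (cases "\<exists>q. flip_related E V g (prod.swap p) q")
    case True
    then obtain q where q: "flip_related E V g (prod.swap p) q" by auto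
    then have "flip_related (E\<inverse>) V g p (prod.swap q)"
      using flip_related_converse[of E V g "prod.swap p" q] by simp
    then show ?thesis using q flip_perm_eqI conv.flip_perm_eqI by auto
  next
    case False
    then have "\<not> (\<exists>q. flip_related (E\<inverse>) V g p q)"
      using flip_related_converse[of E V g "prod.swap p"] by (metis swap_swap)
    then show ?thesis using False by (simp add: flip_perm_def)
  qed
qed

text \<open>Paths of \<open>G\<close> that leave \<open>V\<close> do not affect flips: agreement outside the smaller region below
  (above) \<open>g\<close> implies agreement outside the larger one.\<close>

lemma flip_perm_Restr:
  assumes "finite V"
  shows "flip_perm (Restr E V) V g = flip_perm E V g"
proof
  fix p
  interpret R: dag "Restr E V" by (rule dag_Restr)
  have sub: "(Restr E V)\<^sup>* \<subseteq> E\<^sup>*" by (rule rtrancl_mono) auto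
  show "flip_perm (Restr E V) V g p = flip_perm E V g p"
  proof (cases "p \<in> tpairs E V")
    case True
    then have "p \<in> tpairs (Restr E V) V" by (simp add: tpairs_Restr)
    with assms show ?thesis
    proof (cases rule: R.flip_perm_cases[where g = g])
      case 1
      then have "flip_related E V g p (flip_perm (Restr E V) V g p)"
        using sub unfolding flip_related_def up_flip_def tpairs_Restr by blast
      then show ?thesis using flip_perm_eqI by metis
    next
      case 2
      then show ?thesis using flip_perm_fixed by metis
    qed
  next
    case False
    then show ?thesis using flip_perm_outside R.flip_perm_outside by (metis tpairs_Restr)
  qed
qed

end

section \<open>Groups of permutations containing 3-cycles\<close>

text \<open>Products without inverses. All generators here are involutions, so these already form
  the generated group (\<open>perm_closed_words\<close>, \<open>generate_eq_words\<close>).\<close>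

inductive_set words :: "('c \<Rightarrow> 'c) set \<Rightarrow> ('c \<Rightarrow> 'c) set" for F where
  words_id: "id \<in> words F"
| words_step: "f \<in> F \<Longrightarrow> w \<in> words F \<Longrightarrow> f \<circ> w \<in> words F"

lemma words_incl: "f \<in> F \<Longrightarrow> f \<in> words F"
  using words_step[OF _ words_id, of f F] by simp

lemma words_comp:
  assumes "v \<in> words F" "w \<in> words F"
  shows "v \<circ> w \<in> words F"
  using assms by (induction v) (auto simp: comp_assoc intro: words_step)

lemma words_permutes:
  assumes "w \<in> words F" "\<And>f. f \<in> F \<Longrightarrow> f permutes P"
  shows "w permutes P"
  using assms by (induction w) (auto intro: permutes_id permutes_compose)

definition cyc3 :: "'c \<Rightarrow> 'c \<Rightarrow> 'c \<Rightarrow> 'c \<Rightarrow> 'c" where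
  "cyc3 a b c = Transposition.transpose a b \<circ> Transposition.transpose b c"

lemma cyc3_apply:
  assumes "a \<noteq> b" "b \<noteq> c" "a \<noteq> c"
  shows "cyc3 a b c a = b" "cyc3 a b c b = c" "cyc3 a b c c = a"
    "x \<noteq> a \<Longrightarrow> x \<noteq> b \<Longrightarrow> x \<noteq> c \<Longrightarrow> cyc3 a b c x = x"
  using assms by (auto simp: cyc3_def transpose_def)

lemma cyc3_eqI:
  assumes "a \<noteq> b" "b \<noteq> c" "a \<noteq> c" "f a = b" "f b = c" "f c = a"
    "\<And>x. x \<noteq> a \<Longrightarrow> x \<noteq> b \<Longrightarrow> x \<noteq> c \<Longrightarrow> f x = x"
  shows "f = cyc3 a b c"
proof
  fix x
  show "f x = cyc3 a b c x"
    using assms cyc3_apply[OF assms(1-3)] by (cases "x = a \<or> x = b \<or> x = c") auto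
qed

lemma cyc3_rotate: "a \<noteq> b \<Longrightarrow> b \<noteq> c \<Longrightarrow> a \<noteq> c \<Longrightarrow> cyc3 a b c = cyc3 b c a"
  by (intro cyc3_eqI) (simp_all add: cyc3_apply)

lemma inv_cyc3: "Hilbert_Choice.inv (cyc3 a b c) = cyc3 c b a"
  by (rule inv_unique_comp) (auto simp: cyc3_def fun_eq_iff transpose_commute[of c b] transpose_commute[of b a])

lemma cyc3_conjugate:
  assumes "bij f" "a \<noteq> b" "b \<noteq> c" "a \<noteq> c"
  shows "f \<circ> cyc3 a b c \<circ> Hilbert_Choice.inv f = cyc3 (f a) (f b) (f c)"
proof (rule cyc3_eqI)
  have inj: "f x = f y \<longleftrightarrow> x = y" for x y using assms(1) by (simp add: bij_is_inj inj_eq)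
  show "f a \<noteq> f b" "f b \<noteq> f c" "f a \<noteq> f c" using assms inj by auto
  show "(f \<circ> cyc3 a b c \<circ> Hilbert_Choice.inv f) x = x" if "x \<noteq> f a" "x \<noteq> f b" "x \<noteq> f c" for x
  proof -
    obtain y where "x = f y" using assms(1) by (metis bij_pointE)
    then have "y \<noteq> a" "y \<noteq> b" "y \<noteq> c" using that by auto
    then show ?thesis using \<open>x = f y\<close> assms by (simp add: inv_f_f bij_is_inj cyc3_apply(4))
  qed
qed (use assms in \<open>simp_all add: inv_f_f bij_is_inj cyc3_apply\<close>)

section \<open>From overlapping 3-cycles to the alternating group\<close>

locale perm_closed =
  fixes H :: "('c \<Rightarrow> 'c) set"
  assumes comp_closed: "f \<in> H \<Longrightarrow> g \<in> H \<Longrightarrow> f \<circ> g \<in> H"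
    and inv_closed: "f \<in> H \<Longrightarrow> Hilbert_Choice.inv f \<in> H"
    and id_closed: "id \<in> H"
    and bij_closed: "f \<in> H \<Longrightarrow> bij f"
begin

definition tri :: "'c \<Rightarrow> 'c \<Rightarrow> 'c \<Rightarrow> bool" where
  "tri a b c \<longleftrightarrow> a \<noteq> b \<and> b \<noteq> c \<and> a \<noteq> c \<and> cyc3 a b c \<in> H"

text \<open>An equivalence relation; distinct points of one class always span a 3-cycle of
  \<open>H\<close> (\<open>tri_if_sim\<close>). The first alternative supplies reflexivity at points
  that no 3-cycle of \<open>H\<close> moves.\<close>

definition sim :: "'c \<Rightarrow> 'c \<Rightarrow> bool" where
  "sim x y \<longleftrightarrow> x = y \<or> (\<exists>z. tri x y z)"

lemma tri_rotate: "tri a b c \<Longrightarrow> tri b c a"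
  using cyc3_rotate[of a b c] by (auto simp: tri_def)

lemma tri_rev: "tri a b c \<Longrightarrow> tri c b a"
  using inv_closed[of "cyc3 a b c"] by (auto simp: tri_def inv_cyc3)

lemma tri_swap: "tri a b c \<Longrightarrow> tri b a c"
  using tri_rev tri_rotate by blast

lemma tri_conjugate:
  assumes "tri a b c" "f \<in> H"
  shows "tri (f a) (f b) (f c)"
proof -
  have "bij f" using assms bij_closed by auto
  moreover have "f \<circ> cyc3 a b c \<circ> Hilbert_Choice.inv f \<in> H"
    using assms comp_closed inv_closed by (simp add: tri_def)
  ultimately show ?thesis
    using assms cyc3_conjugate[of f a b c] by (simp add: tri_def bij_is_inj inj_eq)
qed

lemma tri_cyc3:
  assumes "tri a b c" "tri x y z"
  shows "tri (cyc3 a b c x) (cyc3 a b c y) (cyc3 a b c z)"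
  using tri_conjugate[OF assms(2)] assms(1) by (auto simp: tri_def)

lemma tri_distinct: "tri a b c \<Longrightarrow> a \<noteq> b \<and> b \<noteq> c \<and> a \<noteq> c"
  by (auto simp: tri_def)

lemma sim_sym: "sim x y \<Longrightarrow> sim y x"
  using tri_swap by (auto simp: sim_def)

lemma sim_conjugate: "sim x y \<Longrightarrow> f \<in> H \<Longrightarrow> sim (f x) (f y)"
  using tri_conjugate unfolding sim_def by blast

text \<open>Conjugation by the 3-cycle taking \<open>y\<close> to \<open>x\<close> and
  \<open>x\<close> to \<open>z\<close> turns a 3-cycle through \<open>y\<close> and \<open>w\<close>
  into one through \<open>x\<close> and \<open>w\<close>. It fixes \<open>w\<close> unless
  \<open>w = z\<close>, and then \<open>x\<close> and \<open>w\<close> already share a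
  3-cycle.\<close>

lemma sim_trans:
  assumes "sim x y" "sim y w"
  shows "sim x w"
proof (cases "x = y \<or> y = w \<or> x = w")
  case False
  then obtain z v where t: "tri x y z" "tri y w v" using assms by (auto simp: sim_def)
  show ?thesis
  proof (cases "w = z")
    case True
    then show ?thesis using tri_rev[OF tri_rotate[OF t(1)]] by (auto simp: sim_def)
  next
    case w: False
    have "tri (cyc3 y x z y) (cyc3 y x z w) (cyc3 y x z v)"
      using tri_cyc3[OF tri_swap[OF t(1)] t(2)] .
    moreover have "cyc3 y x z y = x" "cyc3 y x z w = w"
      using w False tri_distinct[OF t(1)] tri_distinct[OF t(2)]
        cyc3_apply(1)[of y x z] cyc3_apply(4)[of y x z w] by auto
    ultimately have "tri x w (cyc3 y x z v)" by simp
    then show ?thesis by (auto simp: sim_def)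
  qed
qed (use assms in \<open>auto simp: sim_def\<close>)

text \<open>Start from a 3-cycle on \<open>a\<close>, \<open>b\<close>, \<open>z\<close> with
  \<open>z\<close> different from \<open>c\<close>. Conjugating by a 3-cycle through
  \<open>c\<close> and \<open>z\<close>, suitably oriented, moves its support to \<open>a\<close>,
  \<open>b\<close>, \<open>c\<close>. If the third point of the conjugating cycle is neither
  \<open>a\<close> nor \<open>b\<close>, the order is right at once; otherwise rotation and reversal
  repair it.\<close>

lemma tri_if_sim:
  assumes "a \<noteq> b" "b \<noteq> c" "a \<noteq> c" "sim a b" "sim b c"
  shows "tri a b c"
proof -
  obtain z where z: "tri a b z" using assms by (auto simp: sim_def)
  show ?thesis
  proof (cases "z = c")
    case False
    have "sim b z" using z tri_rotate unfolding sim_def by blast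
    then have "sim c z" using sim_trans[OF sim_sym[OF assms(5)]] by blast
    then obtain w where w: "tri c z w" using False by (auto simp: sim_def)
    note d = tri_distinct[OF z] tri_distinct[OF w] assms(1-3) False
    consider "w = a" | "w = b" | "w \<noteq> a" "w \<noteq> b" by blast
    then show ?thesis
    proof cases
      case 1
      have "tri (cyc3 c z a a) (cyc3 c z a b) (cyc3 c z a z)"
        using tri_cyc3[OF w[unfolded 1] z] .
      then have "tri c b a" using d 1 by (simp add: cyc3_apply)
      then show ?thesis by (rule tri_rev)
    next
      case 2
      have "tri (cyc3 c z b a) (cyc3 c z b b) (cyc3 c z b z)"
        using tri_cyc3[OF w[unfolded 2] z] .
      then have "tri a c b" using d 2 by (simp add: cyc3_apply)
      then show ?thesis using tri_rev tri_rotate by blast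
    next
      case 3
      have "tri (cyc3 z c w a) (cyc3 z c w b) (cyc3 z c w z)"
        using tri_cyc3[OF tri_swap[OF w] z] .
      then show ?thesis using d 3 by (simp add: cyc3_apply)
    qed
  qed (use z in simp)
qed

text \<open>Inserting \<open>transpose b c\<close> twice splits the product into two products whose
  factors share a letter, and each of these is a 3-cycle or the identity.\<close>

lemma transpose_pair_closed:
  assumes tri: "\<And>x y z. x \<in> P \<Longrightarrow> y \<in> P \<Longrightarrow> z \<in> P \<Longrightarrow> x \<noteq> y \<Longrightarrow> y \<noteq> z \<Longrightarrow> x \<noteq> z \<Longrightarrow> cyc3 x y z \<in> H"
    and P: "a \<in> P" "b \<in> P" "c \<in> P" "d \<in> P" "a \<noteq> b" "c \<noteq> d"
  shows "Transposition.transpose a b \<circ> Transposition.transpose c d \<in> H"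
proof -
  have shared: "Transposition.transpose x y \<circ> Transposition.transpose y z \<in> H"
    if "x \<in> P" "y \<in> P" "z \<in> P" "x \<noteq> y" "y \<noteq> z" for x y z
  proof (cases "x = z")
    case True
    then have "Transposition.transpose x y \<circ> Transposition.transpose y z = id"
      by (auto simp: fun_eq_iff transpose_def)
    then show ?thesis using id_closed by simp
  next
    case False
    then show ?thesis using tri[of x y z] that by (simp add: cyc3_def)
  qed
  show ?thesis
  proof (cases "b = c")
    case True
    then show ?thesis using shared[of a b d] P by simp
  next
    case False
    have "Transposition.transpose a b \<circ> Transposition.transpose b c
        \<circ> (Transposition.transpose b c \<circ> Transposition.transpose c d) \<in> H"
      using shared[of a b c] shared[of b c d] P False comp_closed by blast
    then show ?thesis
      by (simp add: comp_assoc) (simp add: comp_assoc[symmetric] transpose_comp_involutory)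
  qed
qed

lemma alternating_on_subset:
  assumes tri: "\<And>x y z. x \<in> P \<Longrightarrow> y \<in> P \<Longrightarrow> z \<in> P \<Longrightarrow> x \<noteq> y \<Longrightarrow> y \<noteq> z \<Longrightarrow> x \<noteq> z \<Longrightarrow> cyc3 x y z \<in> H"
    and fin: "finite P"
  shows "alternating_on P \<subseteq> H"
proof
  fix \<sigma> assume "\<sigma> \<in> alternating_on P"
  then have \<sigma>: "\<sigma> permutes P" "evenperm \<sigma>" by (auto simp: alternating_on_def)
  show "\<sigma> \<in> H"
  proof (cases "\<exists>a\<in>P. \<exists>b\<in>P. a \<noteq> b")
    case False
    then have "\<sigma> = id"
      using \<sigma>(1) by (metis eq_id_iff permutes_in_image permutes_not_in)
    then show ?thesis using id_closed by simp
  next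
    case True
    then obtain a b where ab: "a \<in> P" "b \<in> P" "a \<noteq> b" by auto
    \<comment> \<open>Induction multiplies by one transposition at a time and so passes through odd
      permutations; these are brought into \<open>H\<close> by the fixed transposition of
      \<open>a\<close> and \<open>b\<close>.\<close>
    have "(evenperm p \<longrightarrow> p \<in> H) \<and>
        (\<not> evenperm p \<longrightarrow> Transposition.transpose a b \<circ> p \<in> H)" if "p permutes P" for p
      using that fin
    proof (induction p rule: permutes_induct)
      case id
      then show ?case using id_closed evenperm_id by blast
    next
      case (swap c d p)
      have even: "evenperm (Transposition.transpose c d \<circ> p) \<longleftrightarrow> \<not> evenperm p"
        using swap fin by (simp add: evenperm_comp permutation_swap_id permutes_imp_permutation evenperm_swap)
      note pair = transpose_pair_closed[OF tri, of P]
      have 1: "Transposition.transpose a b \<circ> (Transposition.transpose c d \<circ> p) \<in> H" if "p \<in> H"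
        using comp_closed[OF pair[of a b c d] that] ab swap by (simp add: comp_assoc)
      have 2: "Transposition.transpose c d \<circ> p \<in> H" if "Transposition.transpose a b \<circ> p \<in> H"
      proof -
        have "(Transposition.transpose c d \<circ> Transposition.transpose a b) \<circ> (Transposition.transpose a b \<circ> p) \<in> H"
          using comp_closed[OF pair[of c d a b] that] ab swap by blast
        also have "(Transposition.transpose c d \<circ> Transposition.transpose a b) \<circ> (Transposition.transpose a b \<circ> p)
            = Transposition.transpose c d \<circ> p"
          by (simp add: fun_eq_iff)
        finally show ?thesis .
      qed
      show ?case using 1 2 swap even by blast
    qed
    then show ?thesis using \<sigma> by blast
  qed
qed

end

lemma perm_closed_words:
  assumes "\<And>f. f \<in> F \<Longrightarrow> f \<circ> f = id"
  shows "perm_closed (words F)"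
proof -
  have "bij w \<and> Hilbert_Choice.inv w \<in> words F" if "w \<in> words F" for w
    using that
  proof (induction w)
    case words_id
    show ?case by (simp only: inv_id words.words_id bij_id)
  next
    case (words_step f w)
    have f: "bij f" "Hilbert_Choice.inv f = f"
      using assms[OF words_step(1)] o_bij inv_unique_comp by blast+
    have w: "bij w" "Hilbert_Choice.inv w \<in> words F" using words_step.IH by auto
    have "Hilbert_Choice.inv (f \<circ> w) = Hilbert_Choice.inv w \<circ> f"
      using o_inv_distrib[OF f(1) w(1)] f(2) by simp
    then show ?case
      using words_comp[OF w(2) words_incl[OF words_step(1)]] bij_comp[OF w(1) f(1)] by (simp only:)
  qed
  then show ?thesis by unfold_locales (auto intro: words_comp words.words_id)
qed

section \<open>The flip group of a connected graph\<close>

definition flip_words :: "('a \<times> 'a) set \<Rightarrow> 'a set \<Rightarrow> ('a set_pair \<Rightarrow> 'a set_pair) set" where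
  "flip_words E V = words (flip_perm E V ` V)"

text \<open>Vacuous for a single vertex, which has only two tight pairs; this is the bottom of the
  induction.\<close>

definition has_3cycles :: "('a \<times> 'a) set \<Rightarrow> 'a set \<Rightarrow> bool" where
  "has_3cycles E V \<longleftrightarrow> (\<forall>a\<in>tpairs E V. \<forall>b\<in>tpairs E V. \<forall>c\<in>tpairs E V.
     a \<noteq> b \<longrightarrow> b \<noteq> c \<longrightarrow> a \<noteq> c \<longrightarrow> cyc3 a b c \<in> flip_words E V)"

text \<open>Undirected connectedness in terms of cuts rather than paths, which suits adding and
  deleting vertices; \<open>connected_iff_linked\<close> relates it to the path version.\<close>

definition linked :: "('a \<times> 'a) set \<Rightarrow> 'a set \<Rightarrow> bool" where
  "linked E V \<longleftrightarrow> V \<noteq> {} \<and>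
     (\<forall>A. A \<subseteq> V \<and> A \<noteq> {} \<and> A \<noteq> V \<longrightarrow> (\<exists>x\<in>A. \<exists>y\<in>V - A. (x, y) \<in> E \<or> (y, x) \<in> E))"

lemma linked_cut:
  assumes "linked E V" "A \<subseteq> V" "A \<noteq> {}" "A \<noteq> V"
  obtains x y where "x \<in> A" "y \<in> V" "y \<notin> A" "(x, y) \<in> E \<or> (y, x) \<in> E"
  using assms unfolding linked_def by (metis DiffE)

lemma linked_singleton: "linked E {v}"
  by (auto simp: linked_def)

lemma linked_converse: "linked (E\<inverse>) V \<longleftrightarrow> linked E V"
  by (simp add: linked_def disj_commute)

lemma linked_Restr: "linked (Restr E V) V \<longleftrightarrow> linked E V"
proof -
  have "(\<exists>x\<in>A. \<exists>y\<in>V - A. (x, y) \<in> Restr E V \<or> (y, x) \<in> Restr E V) \<longleftrightarrow>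
      (\<exists>x\<in>A. \<exists>y\<in>V - A. (x, y) \<in> E \<or> (y, x) \<in> E)" if "A \<subseteq> V" for A
    using that by blast
  then show ?thesis unfolding linked_def by blast
qed

lemma linked_insert:
  assumes C: "linked E C" and c: "c \<in> C" "(c, y) \<in> E \<or> (y, c) \<in> E"
  shows "linked E (insert y C)"
proof (cases "y \<in> C")
  case False
  have "\<exists>x\<in>A. \<exists>z\<in>insert y C - A. (x, z) \<in> E \<or> (z, x) \<in> E"
    if A: "A \<subseteq> insert y C" "A \<noteq> {}" "A \<noteq> insert y C" for A
  proof -
    consider "A \<inter> C = {}" | "A \<inter> C = C" | "A \<inter> C \<noteq> {}" "A \<inter> C \<noteq> C" by blast
    then show ?thesis
    proof cases
      case 1
      then have "A = {y}" using A by blast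
      then show ?thesis using c False by auto
    next
      case 2
      then have "A = C" using A by blast
      then show ?thesis using c False by auto
    next
      case 3
      obtain u v where "u \<in> A \<inter> C" "v \<in> C" "v \<notin> A \<inter> C" "(u, v) \<in> E \<or> (v, u) \<in> E"
        using linked_cut[OF C, of "A \<inter> C"] 3 by blast
      then show ?thesis by blast
    qed
  qed
  then show ?thesis by (simp add: linked_def)
qed (use C in \<open>simp add: insert_absorb\<close>)

lemma linked_neighbour:
  assumes "linked E V" "x \<in> V" "V \<noteq> {x}"
  obtains y where "y \<in> V" "y \<noteq> x" "(x, y) \<in> E \<or> (y, x) \<in> E"
  using linked_cut[OF assms(1), of "{x}"] assms by blast

section \<open>Removable sources and sinks; flip groups under duality\<close>

context dag
begin

lemma obtain_source:
  assumes "R \<noteq> {}"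
  obtains s where "s \<in> R" "\<And>x. x \<in> R \<Longrightarrow> (x, s) \<notin> E"
  using wfE_min'[OF wf_E assms] by metis

lemma obtain_sink:
  assumes "R \<noteq> {}"
  obtains t where "t \<in> R" "\<And>x. x \<in> R \<Longrightarrow> (t, x) \<notin> E"
  using wfE_min'[OF wf_converse_E assms] by (metis converse_iff)

text \<open>Sources alone do not suffice: a source with arcs to two leaves is a cut vertex and the
  only source. Take an inclusion-maximal connected \<open>C\<close> that avoids some extremal vertex
  \<open>g\<close>. If a set \<open>R\<close> is left over besides \<open>g\<close>, no vertex of it
  is adjacent to \<open>C\<close>, so \<open>g\<close> is. As \<open>R\<close> contains another
  extremal vertex \<open>h\<close>, adding \<open>g\<close> to \<open>C\<close> gives a larger
  connected set that avoids \<open>h\<close>.\<close>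

lemma linked_remove_extremal:
  assumes fin: "finite V" and V: "linked E V" and two: "\<And>v. V \<noteq> {v}"
  obtains g where "g \<in> V" "linked E (V - {g})" "(\<forall>x\<in>V. (x, g) \<notin> E) \<or> (\<forall>x\<in>V. (g, x) \<notin> E)"
proof -
  define extremal where "extremal g \<longleftrightarrow> (\<forall>x\<in>V. (x, g) \<notin> E) \<or> (\<forall>x\<in>V. (g, x) \<notin> E)" for g
  define Q where "Q = {C. linked E C \<and> (\<exists>g\<in>V. extremal g \<and> C \<subseteq> V - {g})}"
  have "V \<noteq> {}" using V by (auto simp: linked_def)
  then obtain s where s: "s \<in> V" "\<And>x. x \<in> V \<Longrightarrow> (x, s) \<notin> E" using obtain_source by metis
  obtain v where "v \<in> V" "v \<noteq> s" using two s(1) by blast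
  then have "{v} \<in> Q" using s linked_singleton by (auto simp: Q_def extremal_def)
  moreover have "finite Q"
    by (rule finite_subset[of _ "Pow V"]) (use fin in \<open>auto simp: Q_def\<close>)
  ultimately obtain C where C: "C \<in> Q" and max: "\<And>C'. C' \<in> Q \<Longrightarrow> C \<subseteq> C' \<Longrightarrow> C = C'"
    using finite_has_maximal[of Q] by blast
  obtain g where g: "g \<in> V" "extremal g" "C \<subseteq> V - {g}" and lC: "linked E C"
    using C by (auto simp: Q_def)
  have "C = V - {g}"
  proof (rule ccontr)
    assume "C \<noteq> V - {g}"
    define R where "R = V - {g} - C"
    have R: "R \<noteq> {}" using \<open>C \<noteq> V - {g}\<close> g(3) by (auto simp: R_def)
    have sep: "(c, r) \<notin> E \<and> (r, c) \<notin> E" if "r \<in> R" "c \<in> C" for r c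
    proof (rule ccontr)
      assume "\<not> ((c, r) \<notin> E \<and> (r, c) \<notin> E)"
      then have "linked E (insert r C)" using linked_insert[OF lC that(2)] by blast
      then have "insert r C \<in> Q" using that g by (auto simp: Q_def R_def)
      then show False using max[of "insert r C"] that by (auto simp: R_def)
    qed
    have "C \<noteq> {}" "C \<noteq> V" using lC g by (auto simp: linked_def)
    then obtain c y where cy: "c \<in> C" "y \<in> V" "y \<notin> C" "(c, y) \<in> E \<or> (y, c) \<in> E"
      using linked_cut[OF V, of C] g(3) by blast
    then have "y = g" using sep[of y c] by (auto simp: R_def)
    then have lg: "linked E (insert g C)" using linked_insert[OF lC cy(1)] cy(4) by blast
    have V_eq: "V = insert g (C \<union> R)" using g by (auto simp: R_def)
    \<comment> \<open>The kind opposite to \<open>g\<close> is chosen because \<open>g\<close> may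
      be adjacent to \<open>R\<close>: an arc from a source \<open>g\<close> does not spoil a sink
      of \<open>R\<close>.\<close>
    have "\<exists>h\<in>R. extremal h"
    proof (cases "\<forall>x\<in>V. (x, g) \<notin> E")
      case True
      obtain t where t: "t \<in> R" "\<And>x. x \<in> R \<Longrightarrow> (t, x) \<notin> E" using obtain_sink[OF R] by metis
      then have "\<forall>x\<in>V. (t, x) \<notin> E" using sep True V_eq by blast
      then show ?thesis using t by (auto simp: extremal_def)
    next
      case False
      then have sink: "\<forall>x\<in>V. (g, x) \<notin> E" using g by (auto simp: extremal_def)
      obtain t where t: "t \<in> R" "\<And>x. x \<in> R \<Longrightarrow> (x, t) \<notin> E" using obtain_source[OF R] by metis
      then have "\<forall>x\<in>V. (x, t) \<notin> E" using sep sink V_eq by blast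
      then show ?thesis using t by (auto simp: extremal_def)
    qed
    then obtain h where "h \<in> R" "extremal h" by auto
    then have "insert g C \<in> Q" using lg g by (auto simp: Q_def R_def)
    then show False using max[of "insert g C"] g by auto
  qed
  then show ?thesis using that[of g] g lC by (auto simp: extremal_def)
qed

lemma perm_closed_flip_words: "perm_closed (flip_words E V)"
  unfolding flip_words_def
  by (rule perm_closed_words) (auto simp: fun_eq_iff flip_perm_involution)

lemma flip_words_permutes: "w \<in> flip_words E V \<Longrightarrow> w permutes tpairs E V"
  unfolding flip_words_def by (rule words_permutes) (auto intro: flip_perm_permutes)

lemma flip_perm_in_words: "g \<in> V \<Longrightarrow> flip_perm E V g \<in> flip_words E V"
  unfolding flip_words_def by (rule words_incl) auto

lemma has_3cycles_Restr:
  "finite V \<Longrightarrow> has_3cycles (Restr E V) V \<longleftrightarrow> has_3cycles E V"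
  by (simp add: has_3cycles_def flip_words_def tpairs_Restr flip_perm_Restr)

lemma flip_words_converse:
  assumes "w \<in> flip_words E V"
  shows "prod.swap \<circ> w \<circ> prod.swap \<in> flip_words (E\<inverse>) V"
  using assms unfolding flip_words_def
proof (induction w)
  case words_id
  have eq: "prod.swap \<circ> id \<circ> prod.swap = id" by auto
  show ?case unfolding eq by (rule words.words_id)
next
  case (words_step f w)
  then obtain g where g: "g \<in> V" "f = flip_perm E V g" by auto
  have eq: "prod.swap \<circ> (f \<circ> w) \<circ> prod.swap
      = flip_perm (E\<inverse>) V g \<circ> (prod.swap \<circ> w \<circ> prod.swap)"
    by (simp add: fun_eq_iff flip_perm_converse g)
  show ?case unfolding eq by (rule words.words_step[OF _ words_step.IH]) (use g in blast)
qed

lemma has_3cycles_converse: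
  assumes "has_3cycles E V"
  shows "has_3cycles (E\<inverse>) V"
  unfolding has_3cycles_def
proof (intro ballI impI)
  fix a b c
  assume abc: "a \<in> tpairs (E\<inverse>) V" "b \<in> tpairs (E\<inverse>) V" "c \<in> tpairs (E\<inverse>) V"
    and neq: "a \<noteq> b" "b \<noteq> c" "a \<noteq> c"
  have "prod.swap x \<in> tpairs E V" if "x \<in> tpairs (E\<inverse>) V" for x
    using that swap_tpairs[of "prod.swap x" E V] by simp
  moreover have neq': "prod.swap a \<noteq> prod.swap b" "prod.swap b \<noteq> prod.swap c"
      "prod.swap a \<noteq> prod.swap c"
    using neq by (metis swap_swap)+
  ultimately have "cyc3 (prod.swap a) (prod.swap b) (prod.swap c) \<in> flip_words E V"
    using assms abc by (auto simp: has_3cycles_def)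
  then have "prod.swap \<circ> cyc3 (prod.swap a) (prod.swap b) (prod.swap c) \<circ> prod.swap
      \<in> flip_words (E\<inverse>) V" by (rule flip_words_converse)
  also have "prod.swap \<circ> cyc3 (prod.swap a) (prod.swap b) (prod.swap c) \<circ> prod.swap = cyc3 a b c"
  proof (rule cyc3_eqI[OF neq])
    fix p assume "p \<noteq> a" "p \<noteq> b" "p \<noteq> c"
    then have "prod.swap p \<noteq> prod.swap a" "prod.swap p \<noteq> prod.swap b" "prod.swap p \<noteq> prod.swap c"
      by (metis swap_swap)+
    from cyc3_apply(4)[OF neq' this]
    show "(prod.swap \<circ> cyc3 (prod.swap a) (prod.swap b) (prod.swap c) \<circ> prod.swap) p = p" by simp
  qed (simp_all add: cyc3_apply(1-3)[OF neq'])
  finally show "cyc3 a b c \<in> flip_words (E\<inverse>) V" .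
qed

end

section \<open>Deleting a source\<close>

locale dag_source = dag +
  fixes V :: "'a set" and g :: 'a
  assumes finite_V: "finite V" and g_in: "g \<in> V" and source: "(x, g) \<notin> E"
begin

definition drop_g :: "'a set_pair \<Rightarrow> 'a set_pair" where
  "drop_g p = (fst p, snd p - {g})"

lemma rtrancl_source: "(x, g) \<in> E\<^sup>* \<longleftrightarrow> x = g"
  using source by (metis rtrancl.cases rtrancl.rtrancl_refl)

lemma drop_g_in: "p \<in> tpairs E V \<Longrightarrow> g \<notin> fst p \<Longrightarrow> drop_g p \<in> tpairs E (V - {g})"
  unfolding tpairs_iff drop_g_def fst_conv snd_conv using source by blast

text \<open>Nothing lies above a source, so when \<open>g\<close> is outside the first component,
  tightness at \<open>g\<close> is met either by \<open>g\<close> itself or by an out-neighbour in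
  the second component. Hence \<open>drop_g\<close> loses no information on such pairs.\<close>

lemma g_in_snd_iff:
  assumes "p \<in> tpairs E V" "g \<notin> fst p"
  shows "g \<in> snd p \<longleftrightarrow> (\<forall>u\<in>snd p - {g}. (g, u) \<notin> E)"
proof
  show "\<forall>u\<in>snd p - {g}. (g, u) \<notin> E" if "g \<in> snd p"
    using that assms(1) unfolding tpairs_iff by blast
  show "g \<in> snd p" if "\<forall>u\<in>snd p - {g}. (g, u) \<notin> E"
    using that assms g_in source unfolding tpairs_iff by blast
qed

lemma drop_g_inj:
  assumes "p \<in> tpairs E V" "q \<in> tpairs E V" "g \<notin> fst p" "g \<notin> fst q" "drop_g p = drop_g q"
  shows "p = q"
proof -
  have eq: "fst p = fst q" "snd p - {g} = snd q - {g}" using assms(5) by (auto simp: drop_g_def)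
  have "g \<in> snd p \<longleftrightarrow> g \<in> snd q"
    unfolding g_in_snd_iff[OF assms(1,3)] g_in_snd_iff[OF assms(2,4)] eq(2) ..
  then show ?thesis using eq by (intro prod_eqI) auto
qed

lemma drop_g_surj:
  assumes "q \<in> tpairs E (V - {g})"
  obtains p where "p \<in> tpairs E V" "g \<notin> fst p" "drop_g p = q"
proof -
  define U where "U = (if \<exists>u\<in>snd q. (g, u) \<in> E then snd q else insert g (snd q))"
  have q: "fst q \<subseteq> V - {g}" "snd q \<subseteq> V - {g}" using tpairs_subset[OF assms] by auto
  have "(fst q, U) \<in> tpairs E V"
    using assms g_in source unfolding tpairs_iff U_def fst_conv snd_conv by auto
  moreover have "drop_g (fst q, U) = q" using q by (auto simp: drop_g_def U_def prod_eq_iff)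
  ultimately show ?thesis using that[of "(fst q, U)"] q by auto
qed

text \<open>No other vertex reaches the source \<open>g\<close>, so a flip at \<open>h\<close> never
  changes whether \<open>g\<close> is in the first component. Removing \<open>g\<close> from the
  second components preserves \<open>up_flip\<close>, and uniqueness identifies the result.\<close>

lemma flip_drop_g:
  assumes h: "h \<in> V - {g}" and p: "p \<in> tpairs E V" "g \<notin> fst p"
  shows "g \<notin> fst (flip_perm E V h p)"
    "drop_g (flip_perm E V h p) = flip_perm E (V - {g}) h (drop_g p)"
proof -
  have "g \<notin> fst (flip_perm E V h p) \<and>
    drop_g (flip_perm E V h p) = flip_perm E (V - {g}) h (drop_g p)"
    using finite_V p(1)
  proof (cases rule: flip_perm_cases[where g = h])
    case 1
    define q where "q = flip_perm E V h p"
    have rel: "flip_related E V h p q" using 1 by (simp add: q_def)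
    then have q: "q \<in> tpairs E V" by (simp add: flip_related_def)
    have "(h, g) \<notin> E\<^sup>*" using h rtrancl_source by auto
    then have gq: "g \<notin> fst q" using rel p unfolding flip_related_def up_flip_def by blast
    have "up_flip E h (drop_g a) (drop_g b)" if "up_flip E h a b" for a b
      using that h unfolding up_flip_def drop_g_def fst_conv snd_conv by blast
    then have "flip_related E (V - {g}) h (drop_g p) (drop_g q)"
      using rel drop_g_in[OF p] drop_g_in[OF q gq] unfolding flip_related_def by blast
    then show ?thesis using flip_perm_eqI gq by (simp add: q_def)
  next
    case 2
    then show ?thesis using p flip_perm_fixed[of h "drop_g p"] by (simp add: drop_g_def)
  qed
  then show "g \<notin> fst (flip_perm E V h p)"
    "drop_g (flip_perm E V h p) = flip_perm E (V - {g}) h (drop_g p)" by auto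
qed

lemma flip_keeps_source:
  assumes h: "h \<in> V - {g}" and p: "p \<in> tpairs E V" "g \<in> fst p"
  shows "g \<in> fst (flip_perm E V h p)"
proof (rule ccontr)
  assume "g \<notin> fst (flip_perm E V h p)"
  from flip_drop_g(1)[OF h flip_perm_in[OF p(1)] this] show False
    using p(2) by (simp add: flip_perm_involution)
qed

lemma flip_neighbour_fixed:
  assumes "(g, x) \<in> E" "p \<in> tpairs E V" "g \<in> fst p"
  shows "flip_perm E V x p = p"
proof (rule flip_perm_fixed)
  show "x \<notin> fst p" "x \<notin> snd p"
    using tpairs_no_edge[OF assms(2), of g x] tpairs_disjoint[OF assms(2,3)] assms by blast+
qed

text \<open>The same letters, read as flips on \<open>V\<close>. For pairs with \<open>g\<close> in
  the first component only invariance of that block is claimed: the smaller graph says nothing about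
  the action there.\<close>

lemma lift_word:
  assumes "w \<in> flip_words E (V - {g})"
  obtains v where "v \<in> flip_words E V"
    "\<And>p. p \<in> tpairs E V \<Longrightarrow> g \<notin> fst p \<Longrightarrow> g \<notin> fst (v p) \<and> drop_g (v p) = w (drop_g p)"
    "\<And>p. p \<in> tpairs E V \<Longrightarrow> g \<in> fst p \<Longrightarrow> g \<in> fst (v p)"
proof -
  have "\<exists>v\<in>flip_words E V.
    (\<forall>p\<in>tpairs E V. g \<notin> fst p \<longrightarrow> g \<notin> fst (v p) \<and> drop_g (v p) = w (drop_g p)) \<and>
    (\<forall>p\<in>tpairs E V. g \<in> fst p \<longrightarrow> g \<in> fst (v p))"
    using assms unfolding flip_words_def[of E "V - {g}"]
  proof (induction w)
    case words_id
    have "id \<in> flip_words E V" unfolding flip_words_def by (rule words.words_id)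
    then show ?case by (intro bexI[of _ id]) auto
  next
    case (words_step f w)
    then obtain h where h: "h \<in> V - {g}" "f = flip_perm E (V - {g}) h" by auto
    obtain v where v: "v \<in> flip_words E V"
      "\<forall>p\<in>tpairs E V. g \<notin> fst p \<longrightarrow> g \<notin> fst (v p) \<and> drop_g (v p) = w (drop_g p)"
      "\<forall>p\<in>tpairs E V. g \<in> fst p \<longrightarrow> g \<in> fst (v p)"
      using words_step.IH by blast
    have in_V: "v p \<in> tpairs E V" if "p \<in> tpairs E V" for p
      using flip_words_permutes[OF v(1)] that by (simp add: permutes_in_image)
    have "flip_perm E V h \<circ> v \<in> flip_words E V"
      using v(1) h(1) unfolding flip_words_def by (intro words.words_step) auto
    then show ?case
      using v in_V flip_drop_g[OF h(1)] flip_keeps_source[OF h(1)] h(2)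
      by (intro bexI[of _ "flip_perm E V h \<circ> v"]) auto
  qed
  then show ?thesis using that by blast
qed

text \<open>The commutator argument: \<open>flip_perm E V x\<close> does nothing to the pairs with \<open>g\<close> in the first
  component, so commuting it with a lifted 3-cycle kills the uncontrolled action there.\<close>

lemma cyc3_from_neighbour:
  assumes IH: "has_3cycles E (V - {g})" and x: "(g, x) \<in> E" "x \<in> V"
    and a: "a \<in> tpairs E V" "g \<notin> fst a" "flip_perm E V x a \<noteq> a"
    and e: "e \<in> tpairs E V" "g \<notin> fst e" "flip_perm E V x e = e"
  shows "a \<noteq> e \<and> flip_perm E V x a \<noteq> e \<and> cyc3 a (flip_perm E V x a) e \<in> flip_words E V"
proof -
  interpret H: perm_closed "flip_words E V" by (rule perm_closed_flip_words)
  have xg: "x \<in> V - {g}" using x source by auto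
  define \<sigma> where "\<sigma> = flip_perm E V x"
  have \<sigma>\<sigma>: "\<sigma> (\<sigma> p) = p" for p by (simp add: \<sigma>_def flip_perm_involution)
  define b where "b = \<sigma> a"
  have b: "b \<in> tpairs E V" "g \<notin> fst b"
    using a flip_perm_in flip_drop_g(1)[OF xg] by (auto simp: b_def \<sigma>_def)
  have \<sigma>: "\<sigma> a = b" "\<sigma> b = a" "\<sigma> e = e" using \<sigma>\<sigma> e by (auto simp: b_def \<sigma>_def)
  have neq: "a \<noteq> b" "b \<noteq> e" "a \<noteq> e" using a e \<sigma> by (auto simp: \<sigma>_def)
  have neq': "drop_g a \<noteq> drop_g b" "drop_g b \<noteq> drop_g e" "drop_g a \<noteq> drop_g e"
    using neq drop_g_inj a b e by blast+
  have "cyc3 (drop_g a) (drop_g b) (drop_g e) \<in> flip_words E (V - {g})"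
    using IH neq' drop_g_in a b e unfolding has_3cycles_def by blast
  then obtain \<alpha> where \<alpha>: "\<alpha> \<in> flip_words E V"
    "\<And>p. p \<in> tpairs E V \<Longrightarrow> g \<notin> fst p \<Longrightarrow> g \<notin> fst (\<alpha> p) \<and>
      drop_g (\<alpha> p) = cyc3 (drop_g a) (drop_g b) (drop_g e) (drop_g p)"
    "\<And>p. p \<in> tpairs E V \<Longrightarrow> g \<in> fst p \<Longrightarrow> g \<in> fst (\<alpha> p)"
    using lift_word by metis
  have perm: "\<alpha> permutes tpairs E V" using flip_words_permutes[OF \<alpha>(1)] .
  have \<alpha>_eq: "\<alpha> p = q" if "p \<in> tpairs E V" "g \<notin> fst p" "q \<in> tpairs E V" "g \<notin> fst q"
    "cyc3 (drop_g a) (drop_g b) (drop_g e) (drop_g p) = drop_g q" for p q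
    using drop_g_inj[of "\<alpha> p" q] \<alpha>(2)[of p] that perm by (simp add: permutes_in_image)
  have \<alpha>abe: "\<alpha> a = b" "\<alpha> b = e" "\<alpha> e = a"
    using \<alpha>_eq a b e cyc3_apply(1-3)[OF neq'] by simp_all
  have \<alpha>_fix: "\<alpha> p = p" if "p \<in> tpairs E V" "g \<notin> fst p" "p \<noteq> a" "p \<noteq> b" "p \<noteq> e" for p
  proof -
    have "drop_g p \<noteq> drop_g a" "drop_g p \<noteq> drop_g b" "drop_g p \<noteq> drop_g e"
      using that drop_g_inj a b e by blast+
    then show ?thesis using \<alpha>_eq[of p p] that cyc3_apply(4)[OF neq'] by simp
  qed
  have inv_eq: "Hilbert_Choice.inv \<alpha> q = p" if "\<alpha> p = q" for p q
    using that permutes_inverses(2)[OF perm, of p] by simp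
  \<comment> \<open>\<open>\<sigma>\<close> is its own inverse, so this is a commutator. On the
    pairs without \<open>g\<close> in the first component, \<open>\<alpha>\<close> is a 3-cycle and
    conjugation by \<open>\<sigma>\<close>, which swaps \<open>a\<close> and \<open>b\<close> and
    fixes \<open>e\<close>, inverts it; \<open>f\<close> acts there as the inverse square of
    \<open>\<alpha>\<close>, which is \<open>\<alpha>\<close> again. On the other tight pairs
    \<open>\<sigma>\<close> is trivial and \<open>\<alpha>\<close> cancels.\<close>
  define f where "f = \<sigma> \<circ> \<alpha> \<circ> \<sigma> \<circ> Hilbert_Choice.inv \<alpha>"
  have "\<sigma> \<in> flip_words E V" unfolding \<sigma>_def using x(2) by (rule flip_perm_in_words)
  then have "f \<in> flip_words E V"
    unfolding f_def using \<alpha>(1) by (intro H.comp_closed H.inv_closed)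
  moreover have "f = cyc3 a b e"
  proof (rule cyc3_eqI[OF neq])
    show "f a = b" "f b = e" "f e = a"
      using inv_eq[OF \<alpha>abe(1)] inv_eq[OF \<alpha>abe(2)] inv_eq[OF \<alpha>abe(3)] \<alpha>abe \<sigma> by (simp_all add: f_def)
    fix p assume p: "p \<noteq> a" "p \<noteq> b" "p \<noteq> e"
    consider "p \<notin> tpairs E V" | "p \<in> tpairs E V" "g \<notin> fst p" | "p \<in> tpairs E V" "g \<in> fst p" by blast
    then show "f p = p"
    proof cases
      case 1
      then have "\<sigma> p = p" "\<alpha> p = p"
        using flip_perm_outside permutes_not_in[OF perm] by (auto simp: \<sigma>_def)
      then show ?thesis using inv_eq[of p p] by (simp add: f_def)
    next
      case 2
      have "\<alpha> p = p" using \<alpha>_fix 2 p by blast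
      moreover have "\<alpha> (\<sigma> p) = \<sigma> p"
      proof (rule \<alpha>_fix)
        show "\<sigma> p \<in> tpairs E V" "g \<notin> fst (\<sigma> p)"
          using 2 flip_perm_in flip_drop_g(1)[OF xg] by (auto simp: \<sigma>_def)
        show "\<sigma> p \<noteq> a" "\<sigma> p \<noteq> b" "\<sigma> p \<noteq> e" using p \<sigma> \<sigma>\<sigma> by metis+
      qed
      ultimately show ?thesis using inv_eq[of p p] \<sigma>\<sigma> by (simp add: f_def)
    next
      case 3
      define q where "q = Hilbert_Choice.inv \<alpha> p"
      have \<alpha>q: "\<alpha> q = p" using permutes_inverses(1)[OF perm] by (simp add: q_def)
      then have q: "q \<in> tpairs E V" using 3(1) permutes_in_image[OF perm] by metis
      then have "g \<in> fst q" using \<alpha>(2)[of q] \<alpha>q 3(2) by auto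
      then have "\<sigma> q = q" "\<sigma> p = p"
        using flip_neighbour_fixed x(1) q 3 by (auto simp: \<sigma>_def)
      then show ?thesis using \<alpha>q by (simp add: f_def q_def[symmetric])
    qed
  qed
  ultimately show ?thesis using neq by (auto simp: b_def \<sigma>_def)
qed

lemma has_3cycles_source_step:
  assumes IH: "has_3cycles E (V - {g})" and V: "linked E V" and W: "linked E (V - {g})"
    and two: "\<And>v. V - {g} \<noteq> {v}"
  shows "has_3cycles E V"
proof -
  interpret H: perm_closed "flip_words E V" by (rule perm_closed_flip_words)
  have "V \<noteq> {g}" using W by (auto simp: linked_def)
  then obtain x where x: "x \<in> V" "(g, x) \<in> E" "x \<noteq> g"
    using linked_neighbour[OF V g_in] source by metis
  have loop: "(z, z) \<notin> E" for z using trancl_irrefl by blast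
  \<comment> \<open>Prescribing \<open>{y}\<close> as one of the two sets yields a pair on
    \<open>V - {g}\<close> with \<open>x\<close> in neither set. It extends to the pair
    \<open>e\<close> that the commutator needs.\<close>
  obtain y where y: "y \<in> V - {g}" "y \<noteq> x" "(x, y) \<in> E \<or> (y, x) \<in> E"
    using linked_neighbour[OF W _ two] x by blast
  obtain a where a: "a \<in> tpairs E V" "fst a = {x}"
    using tpairs_fst_exists[of V "{x}"] finite_V x loop by auto
  have a_moved: "flip_perm E V x a \<noteq> a" and ga: "g \<notin> fst a"
    using flip_perm_neq flip_perm_related[OF finite_V a(1), of x] a(2) x by auto
  obtain e where e: "e \<in> tpairs E V" "g \<notin> fst e" "flip_perm E V x e = e"
  proof -
    have "\<exists>q\<in>tpairs E (V - {g}). x \<notin> fst q \<and> x \<notin> snd q"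
    proof (cases "(x, y) \<in> E")
      case True
      obtain q where q: "q \<in> tpairs E (V - {g})" "snd q = {y}"
        using tpairs_snd_exists[of "V - {g}" "{y}"] finite_V y loop by auto
      then show ?thesis using tpairs_no_edge[OF q(1), of x y] tpairs_disjoint[OF q(1), of y] True y(2) by blast
    next
      case False
      obtain q where q: "q \<in> tpairs E (V - {g})" "fst q = {y}"
        using tpairs_fst_exists[of "V - {g}" "{y}"] finite_V y loop by auto
      then show ?thesis
        using tpairs_no_edge[OF q(1), of y x] tpairs_disjoint[OF q(1), of y] False y(2,3) by blast
    qed
    then obtain q where q: "q \<in> tpairs E (V - {g})" "x \<notin> fst q" "x \<notin> snd q" by auto
    obtain p where p: "p \<in> tpairs E V" "g \<notin> fst p" "drop_g p = q" using drop_g_surj[OF q(1)] .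
    then have "flip_perm E V x p = p"
      using q x(3) by (intro flip_perm_fixed) (auto simp: drop_g_def)
    then show ?thesis using that p by blast
  qed
  note cyc = cyc3_from_neighbour[OF IH x(2,1)]
  have tri: "H.tri p (flip_perm E V x p) q"
    if "p \<in> tpairs E V" "g \<notin> fst p" "flip_perm E V x p \<noteq> p"
      "q \<in> tpairs E V" "g \<notin> fst q" "flip_perm E V x q = q" for p q
    using cyc[OF that] that(3) unfolding H.tri_def by auto
  have sim_ae: "H.sim a e"
    using H.tri_rotate[OF H.tri_rotate[OF tri[OF a(1) ga a_moved e]]] H.sim_sym unfolding H.sim_def by blast
  \<comment> \<open>Pairs fixed by the flip at \<open>x\<close> are related to the moved pair
    \<open>a\<close>, moved pairs to the fixed pair \<open>e\<close>.\<close>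
  have sim0: "H.sim p e" if p: "p \<in> tpairs E V" "g \<notin> fst p" for p
  proof (cases "flip_perm E V x p = p")
    case True
    have "H.sim p a"
      using H.tri_rotate[OF H.tri_rotate[OF tri[OF a(1) ga a_moved p True]]] unfolding H.sim_def by blast
    then show ?thesis using sim_ae H.sim_trans by blast
  next
    case False
    show ?thesis
      using H.tri_rotate[OF H.tri_rotate[OF tri[OF p False e]]] H.sim_sym unfolding H.sim_def by blast
  qed
  \<comment> \<open>The bridge between the two blocks: with \<open>{x}\<close> as second component,
    the predecessor \<open>g\<close> of \<open>x\<close> can be in neither set, so the flip at
    \<open>g\<close> fixes \<open>k\<close>. Conjugation by this flip then carries the relation of
    \<open>q\<close> to \<open>k\<close> over to the pair \<open>p\<close> beyond the
    bridge.\<close>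
  obtain k where k: "k \<in> tpairs E V" "snd k = {x}"
    using tpairs_snd_exists[of V "{x}"] finite_V x loop by auto
  have gk: "g \<notin> fst k" "g \<notin> snd k"
    using tpairs_no_edge[OF k(1), of g x] x tpairs_disjoint[OF k(1), of x] k(2) by auto
  have sim: "H.sim p e" if p: "p \<in> tpairs E V" for p
  proof (cases "g \<in> fst p")
    case True
    define q where "q = flip_perm E V g p"
    have "flip_related E V g p q"
      using flip_perm_related[OF finite_V p] True by (simp add: q_def)
    then have q: "q \<in> tpairs E V" "g \<in> snd q"
      using True tpairs_disjoint[OF p True] unfolding flip_related_def up_flip_def by blast+
    then have "g \<notin> fst q" using tpairs_disjoint by metis
    then have "H.sim q k"
      using sim0[OF q(1)] sim0[OF k(1) gk(1)] H.sim_sym H.sim_trans by blast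
    then have "H.sim (flip_perm E V g q) (flip_perm E V g k)"
      using flip_perm_in_words[OF g_in] by (rule H.sim_conjugate)
    then have "H.sim p k"
      using flip_perm_fixed[OF gk] by (simp add: q_def flip_perm_involution)
    then show ?thesis using sim0[OF k(1) gk(1)] H.sim_trans by blast
  qed (use sim0 p in blast)
  show ?thesis
    unfolding has_3cycles_def
  proof (intro ballI impI)
    fix p q r
    assume "p \<in> tpairs E V" "q \<in> tpairs E V" "r \<in> tpairs E V" "p \<noteq> q" "q \<noteq> r" "p \<noteq> r"
    then have "H.tri p q r"
      by (metis H.tri_if_sim sim H.sim_sym H.sim_trans)
    then show "cyc3 p q r \<in> flip_words E V" by (simp add: H.tri_def)
  qed
qed

text \<open>The general step fails here: the flip at \<open>x\<close> moves both tight pairs on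
  \<open>{x}\<close>, so there is no fixed pair \<open>e\<close>. Instead, the three tight pairs
  form a chain with labels \<open>x\<close> and \<open>g\<close>, and the product of the two flips
  is a 3-cycle.\<close>

lemma has_3cycles_two_vertices:
  assumes V: "V = {g, x}" and gx: "(g, x) \<in> E"
  shows "has_3cycles E V"
proof -
  interpret H: perm_closed "flip_words E V" by (rule perm_closed_flip_words)
  have no: "(g, g) \<notin> E" "(x, x) \<notin> E" "(x, g) \<notin> E" "g \<noteq> x" "x \<noteq> g"
    using source gx trancl_irrefl by blast+
  define p1 p2 p3 :: "'a set_pair" where "p1 = ({}, {x})" and "p2 = ({x}, {g})" and "p3 = ({g}, {})"
  have P: "p1 \<in> tpairs E V" "p2 \<in> tpairs E V" "p3 \<in> tpairs E V"
    using no gx by (auto simp: p1_def p2_def p3_def tpairs_iff V)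
  have neq: "p1 \<noteq> p2" "p2 \<noteq> p3" "p1 \<noteq> p3" by (auto simp: p1_def p2_def p3_def)
  have all: "p = p1 \<or> p = p2 \<or> p = p3" if p: "p \<in> tpairs E V" for p
  proof -
    have "fst p \<in> Pow {g, x}" "snd p \<in> Pow {g, x}" using tpairs_subset[OF p] V by auto
    then have "fst p \<in> {{}, {g}, {x}, {g, x}}" "snd p \<in> {{}, {g}, {x}, {g, x}}" by blast+
    moreover obtain D U where "p = (D, U)" by fastforce
    ultimately show ?thesis
      using p no gx by (auto simp: p1_def p2_def p3_def tpairs_iff V)
  qed
  have "up_flip E x p1 p2" "up_flip E g p2 p3"
    using no gx by (auto simp: p1_def p2_def p3_def up_flip_def)
  then have rel: "flip_related E V x p1 p2" "flip_related E V g p2 p3"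
    using P by (simp_all add: flip_related_def)
  have flips: "flip_perm E V x p1 = p2" "flip_perm E V g p2 = p3"
      "flip_perm E V x p2 = p1" "flip_perm E V g p3 = p2"
    using rel[THEN flip_perm_eqI] rel[THEN flip_related_sym, THEN flip_perm_eqI] by simp_all
  have flips': "flip_perm E V x p3 = p3" "flip_perm E V g p1 = p1"
    using no by (auto intro!: flip_perm_fixed simp: p1_def p3_def)
  have "flip_perm E V x \<circ> flip_perm E V g = cyc3 p1 p2 p3"
  proof (rule cyc3_eqI[OF neq])
    fix p assume "p \<noteq> p1" "p \<noteq> p2" "p \<noteq> p3"
    then have "p \<notin> tpairs E V" using all by blast
    then show "(flip_perm E V x \<circ> flip_perm E V g) p = p" by (simp add: flip_perm_outside)
  qed (simp_all add: flips flips')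
  moreover have "flip_perm E V x \<circ> flip_perm E V g \<in> flip_words E V"
    using V by (intro H.comp_closed flip_perm_in_words) auto
  ultimately have tri: "H.tri p1 p2 p3" using neq by (simp add: H.tri_def)
  have "H.sim p p2" if "p \<in> tpairs E V" for p
    using all[OF that] tri H.tri_rev[OF tri] unfolding H.sim_def by blast
  then have "H.tri p q r" if "p \<in> tpairs E V" "q \<in> tpairs E V" "r \<in> tpairs E V"
    "p \<noteq> q" "q \<noteq> r" "p \<noteq> r" for p q r
    using that by (metis H.tri_if_sim H.sim_sym H.sim_trans)
  then show ?thesis by (auto simp: has_3cycles_def H.tri_def)
qed

end

theorem has_3cycles_linked:
  assumes "dag E" "finite V" "E \<subseteq> V \<times> V" "linked E V"
  shows "has_3cycles E V"
  using assms
proof (induction "card V" arbitrary: E V rule: less_induct)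
  case less
  interpret dag E by fact
  \<comment> \<open>Stated for any relation \<open>F\<close> on \<open>V\<close>, since for a sink
    of \<open>E\<close> it is applied to \<open>E\<inverse>\<close>.\<close>
  have source_case: "has_3cycles F V"
    if F: "dag F" "F \<subseteq> V \<times> V" "linked F V" and g: "g \<in> V" "linked F (V - {g})" "\<forall>x\<in>V. (x, g) \<notin> F"
    for F g
  proof -
    interpret F: dag_source F V g
      using F less.prems(2) g by (intro dag_source.intro dag_source_axioms.intro) auto
    have V: "V = insert g (V - {g})" using g by auto
    show ?thesis
    proof (cases "\<exists>v. V - {g} = {v}")
      case True
      then obtain v where v: "V - {g} = {v}" by auto
      then have "(g, v) \<in> F"
        using linked_neighbour[OF F(3) g(1)] g(3) by (metis Diff_iff insertCI insertE empty_iff)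
      then show ?thesis using F.has_3cycles_two_vertices V v by metis
    next
      case False
      have "card (V - {g}) < card V" using g(1) less.prems(2) by (intro psubset_card_mono) auto
      \<comment> \<open>The induction hypothesis asks for a relation inside the smaller vertex set;
        the restriction has the same tight pairs and the same flips.\<close>
      then have "has_3cycles (Restr F (V - {g})) (V - {g})"
        using F.dag_Restr g(2) less.prems(2)
        by (intro less.hyps) (auto simp: linked_Restr)
      then have "has_3cycles F (V - {g})"
        using less.prems(2) F.has_3cycles_Restr by simp
      then show ?thesis using F.has_3cycles_source_step F(3) g(2) False by blast
    qed
  qed
  show ?case
  proof (cases "\<exists>v. V = {v}")
    case True
    then obtain v where v: "V = {v}" by auto
    have "p = ({v}, {}) \<or> p = ({}, {v})" if "p \<in> tpairs E V" for p
    proof -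
      have "(v, v) \<notin> E" using trancl_irrefl by blast
      moreover have "fst p = {} \<or> fst p = {v}" "snd p = {} \<or> snd p = {v}"
        using tpairs_subset[OF that] v by auto
      ultimately show ?thesis using that v by (auto simp: tpairs_iff prod_eq_iff)
    qed
    then show ?thesis unfolding has_3cycles_def by metis
  next
    case False
    then obtain g where g: "g \<in> V" "linked E (V - {g})"
        "(\<forall>x\<in>V. (x, g) \<notin> E) \<or> (\<forall>x\<in>V. (g, x) \<notin> E)"
      using linked_remove_extremal[OF less.prems(2,4)] by blast
    from g(3) show ?thesis
    proof
      assume "\<forall>x\<in>V. (x, g) \<notin> E"
      then show ?thesis using source_case less.prems g by blast
    next
      assume "\<forall>x\<in>V. (g, x) \<notin> E"
      then have "has_3cycles (E\<inverse>) V"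
        using source_case[OF dag_converse] less.prems g by (auto simp: linked_converse)
      then show ?thesis
        using dag.has_3cycles_converse[OF dag_converse] by simp
    qed
  qed
qed

section \<open>Every flip is a cover\<close>

text \<open>The labels are collected without order or multiplicity; the arguments only look at
  maximal and minimal ones.\<close>

inductive flip_path :: "('a \<times> 'a) set \<Rightarrow> 'a set \<Rightarrow> 'a set \<Rightarrow> 'a set_pair \<Rightarrow> 'a set_pair \<Rightarrow> bool"
  for E V where
  path_refl: "flip_path E V {} p p"
| path_step: "p \<in> tpairs E V \<Longrightarrow> q \<in> tpairs E V \<Longrightarrow> up_flip E g p q \<Longrightarrow> flip_path E V M q r \<Longrightarrow>
    flip_path E V (insert g M) p r"

lemma flip_path_empty: "flip_path E V M p q \<Longrightarrow> M = {} \<Longrightarrow> p = q"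
  by (induction rule: flip_path.induct) auto

lemma flip_path_trans: "flip_path E V M p q \<Longrightarrow> flip_path E V N q r \<Longrightarrow> flip_path E V (M \<union> N) p r"
  by (induction rule: flip_path.induct) (auto intro: path_step)

text \<open>Upward flips at labels not above \<open>m\<close> leave the status of \<open>m\<close> in the first component alone,
  and those at \<open>m\<close> switch it on.\<close>

lemma flip_path_maximal:
  assumes "flip_path E V M p q" "\<And>g. g \<in> M \<Longrightarrow> (g, m) \<in> E\<^sup>* \<Longrightarrow> g = m"
  shows "(m \<in> fst p \<longrightarrow> m \<in> fst q) \<and> (m \<in> M \<longrightarrow> m \<notin> fst p \<and> m \<in> fst q)"
  using assms
proof (induction rule: flip_path.induct)
  case (path_step p q g M r)
  have IH: "(m \<in> fst q \<longrightarrow> m \<in> fst r) \<and> (m \<in> M \<longrightarrow> m \<notin> fst q \<and> m \<in> fst r)"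
    using path_step by blast
  show ?case
  proof (cases "g = m")
    case True
    then have "m \<in> snd p" "m \<in> fst q" using path_step.hyps(3) by (simp_all add: up_flip_def)
    then show ?thesis using IH tpairs_disjoint[OF path_step.hyps(1)] by blast
  next
    case False
    then have "m \<in> fst p \<longleftrightarrow> m \<in> fst q"
      using path_step.hyps(3) path_step.prems[of g] unfolding up_flip_def by blast
    then show ?thesis using IH False by blast
  qed
qed auto

text \<open>A flip at \<open>g\<close> changes the second component only at or above
  \<open>g\<close>, so now the minimal labels are the ones under control: an upward flip at
  \<open>m\<close> switches \<open>m\<close> off, and no other label can switch it on again.\<close>

lemma flip_path_minimal:
  assumes "flip_path E V M p q" "\<And>g. g \<in> M \<Longrightarrow> (m, g) \<in> E\<^sup>* \<Longrightarrow> g = m"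
  shows "(m \<notin> snd p \<longrightarrow> m \<notin> snd q) \<and> (m \<in> M \<longrightarrow> m \<in> snd p \<and> m \<notin> snd q)"
  using assms
proof (induction rule: flip_path.induct)
  case (path_step p q g M r)
  have IH: "(m \<notin> snd q \<longrightarrow> m \<notin> snd r) \<and> (m \<in> M \<longrightarrow> m \<in> snd q \<and> m \<notin> snd r)"
    using path_step by blast
  show ?case
  proof (cases "g = m")
    case True
    then have "m \<in> snd p" "m \<in> fst q" using path_step.hyps(3) by (simp_all add: up_flip_def)
    then show ?thesis using IH tpairs_disjoint[OF path_step.hyps(2)] by blast
  next
    case False
    then have "m \<in> snd p \<longleftrightarrow> m \<in> snd q"
      using path_step.hyps(3) path_step.prems[of g] unfolding up_flip_def by blast
    then show ?thesis using IH False by blast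
  qed
qed auto

definition up_step :: "('a \<times> 'a) set \<Rightarrow> 'a set \<Rightarrow> ('a set_pair \<times> 'a set_pair) set" where
  "up_step E V = {(p, q). p \<in> tpairs E V \<and> q \<in> tpairs E V \<and> (\<exists>g. up_flip E g p q)}"

lemma up_step_flip_path: "(p, q) \<in> (up_step E V)\<^sup>* \<Longrightarrow> \<exists>M. flip_path E V M p q"
proof (induction rule: converse_rtrancl_induct)
  case base
  show ?case using path_refl by blast
next
  case (step p r)
  then obtain M g where "flip_path E V M r q" "p \<in> tpairs E V" "r \<in> tpairs E V" "up_flip E g p r"
    unfolding up_step_def by blast
  from path_step[OF this(2,3,4,1)] show ?case by blast
qed

context dag
begin

lemma maximal_above:
  assumes "m \<in> M"
  obtains k where "k \<in> M" "(k, m) \<in> E\<^sup>*" "\<And>g. g \<in> M \<Longrightarrow> (g, k) \<in> E\<^sup>* \<Longrightarrow> g = k"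
proof -
  define S where "S = {x\<in>M. (x, m) \<in> E\<^sup>*}"
  have "S \<noteq> {}" using assms by (auto simp: S_def)
  from wfE_min'[OF wf_trancl[OF wf_E] this]
  obtain k where k: "k \<in> S" "\<And>y. (y, k) \<in> E\<^sup>+ \<Longrightarrow> y \<notin> S" by blast
  show ?thesis
  proof (rule that[of k])
    show "k \<in> M" "(k, m) \<in> E\<^sup>*" using k(1) by (simp_all add: S_def)
    show "g = k" if g: "g \<in> M" "(g, k) \<in> E\<^sup>*" for g
    proof (rule ccontr)
      assume "g \<noteq> k"
      then have "(g, k) \<in> E\<^sup>+" using g(2) by (auto dest: rtranclD)
      moreover have "g \<in> S" using g k(1) by (auto simp: S_def)
      ultimately show False using k(2) by blast
    qed
  qed
qed

lemma minimal_below: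
  assumes "m \<in> M"
  obtains k where "k \<in> M" "(m, k) \<in> E\<^sup>*" "\<And>g. g \<in> M \<Longrightarrow> (k, g) \<in> E\<^sup>* \<Longrightarrow> g = k"
proof -
  interpret conv: dag "E\<inverse>" by (rule dag_converse)
  show ?thesis
    by (rule conv.maximal_above[OF assms]) (use that in \<open>simp add: rtrancl_converse\<close>)
qed

text \<open>A maximal label would have to be both outside and inside the first component of
  \<open>p\<close>. This is the antisymmetry of the independence poset.\<close>

lemma flip_path_cycle:
  assumes "flip_path E V M p p"
  shows "M = {}"
proof (rule ccontr)
  assume "M \<noteq> {}"
  then obtain m where "m \<in> M" by blast
  then obtain k where "k \<in> M" "\<And>g. g \<in> M \<Longrightarrow> (g, k) \<in> E\<^sup>* \<Longrightarrow> g = k"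
    by (rule maximal_above) blast
  then show False using flip_path_maximal[OF assms, of k] by blast
qed

text \<open>Every label \<open>m\<close> on a detour lies below a maximal label \<open>k\<close>.
  Since \<open>k\<close> enters the first component between \<open>p\<close> and \<open>q\<close>,
  the flip at \<open>g\<close> allows this only for \<open>k\<close> at or below \<open>g\<close>;
  so \<open>m\<close> is at or below \<open>g\<close>, and dually at or above it. Thus
  \<open>g\<close> is the only label, but the part before \<open>z\<close> already puts
  \<open>g\<close> into the first component, while the part after \<open>z\<close> requires it to be
  absent there.\<close>

lemma up_flip_cover:
  assumes pq: "p \<in> tpairs E V" "q \<in> tpairs E V" "up_flip E g p q"
    and M: "flip_path E V M p z" and N: "flip_path E V N z q"
  shows "z = p \<or> z = q"
proof (rule ccontr)
  assume z: "\<not> (z = p \<or> z = q)"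
  have path: "flip_path E V (M \<union> N) p q" using M N by (rule flip_path_trans)
  have only: "m = g" if m: "m \<in> M \<union> N" for m
  proof -
    obtain k where k: "k \<in> M \<union> N" "(k, m) \<in> E\<^sup>*" "\<And>h. h \<in> M \<union> N \<Longrightarrow> (h, k) \<in> E\<^sup>* \<Longrightarrow> h = k"
      by (rule maximal_above[OF m]) blast
    then have "k \<notin> fst p \<and> k \<in> fst q" using flip_path_maximal[OF path, of k] by blast
    then have "(g, k) \<in> E\<^sup>*" using pq(3) unfolding up_flip_def by blast
    then have gm: "(g, m) \<in> E\<^sup>*" using k(2) by (rule rtrancl_trans)
    obtain j where j: "j \<in> M \<union> N" "(m, j) \<in> E\<^sup>*" "\<And>h. h \<in> M \<union> N \<Longrightarrow> (j, h) \<in> E\<^sup>* \<Longrightarrow> h = j"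
      by (rule minimal_below[OF m]) blast
    then have "j \<in> snd p \<and> j \<notin> snd q" using flip_path_minimal[OF path, of j] by blast
    then have "(j, g) \<in> E\<^sup>*" using pq(3) unfolding up_flip_def by blast
    then have "(m, g) \<in> E\<^sup>*" using j(2) rtrancl_trans by metis
    then show ?thesis using gm rtrancl_antisym by blast
  qed
  have "M \<noteq> {}" "N \<noteq> {}" using flip_path_empty[OF M] flip_path_empty[OF N] z by auto
  then have "M = {g}" "N = {g}" using only by blast+
  then have "g \<in> fst z" "g \<notin> fst z"
    using flip_path_maximal[OF M, of g] flip_path_maximal[OF N, of g] by blast+
  then show False by blast
qed

lemma covers_up_step_iff:
  "covers ((up_step E V)\<^sup>* \<inter> tpairs E V \<times> tpairs E V) p q \<and> flip_perm E V g p = q \<longleftrightarrow>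
    p \<in> tpairs E V \<and> q \<in> tpairs E V \<and> up_flip E g p q"
  (is "?L \<longleftrightarrow> ?R")
proof
  assume R: ?R
  have rel: "flip_related E V g p q" using R by (simp add: flip_related_def)
  have "flip_perm E V g p = q" "q \<noteq> p"
    using flip_perm_eqI[OF rel] flip_perm_neq[OF rel] by auto
  moreover have "(p, q) \<in> (up_step E V)\<^sup>*" using R by (auto simp: up_step_def)
  moreover have "z = p \<or> z = q" if z: "(p, z) \<in> (up_step E V)\<^sup>*" "(z, q) \<in> (up_step E V)\<^sup>*" for z
  proof -
    obtain M N where "flip_path E V M p z" "flip_path E V N z q"
      using up_step_flip_path[OF z(1)] up_step_flip_path[OF z(2)] by blast
    then show ?thesis using up_flip_cover[of p V q g M z N] R by blast
  qed
  ultimately show ?L using R unfolding covers_def by blast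
next
  assume L: ?L
  then have pq: "p \<in> tpairs E V" "q \<in> tpairs E V" "p \<noteq> q" "(p, q) \<in> (up_step E V)\<^sup>*"
    by (auto simp: covers_def)
  have "\<exists>r. flip_related E V g p r"
    using L pq(3) by (rule_tac ccontr) (simp add: flip_perm_def)
  then obtain r where r: "flip_related E V g p r" ..
  then have "flip_related E V g p q" using L flip_perm_eqI[OF r] by simp
  \<comment> \<open>If the flip led downwards from \<open>p\<close> to \<open>q\<close>, it would
    close a cycle with the upward chain that witnesses the order relation.\<close>
  moreover have "\<not> up_flip E g q p"
  proof
    assume up: "up_flip E g q p"
    obtain M where M: "flip_path E V M p q" using up_step_flip_path[OF pq(4)] by blast
    have "flip_path E V (insert g M) q q" using path_step[OF pq(2,1) up M] .
    then show False using flip_path_cycle by blast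
  qed
  ultimately show ?R by (simp add: flip_related_def)
qed

end

section \<open>Generators of the flip group\<close>

text \<open>Here \<open>f\<close> is an involution on the listed points, and the list contains each
  of its 2-cycles in at most one orientation: a transposition occurring twice would cancel.\<close>

lemma transposition_product_apply:
  assumes "distinct es" "\<And>p q. (p, q) \<in> set es \<Longrightarrow> f p = q \<and> f q = p \<and> (q, p) \<notin> set es"
  shows "transposition_product es x =
    (if x \<in> fst ` set es \<or> x \<in> snd ` set es then f x else x)"
  using assms
proof (induction es arbitrary: x)
  case Nil
  then show ?case by (simp add: transposition_product_def)
next
  case (Cons e es)
  obtain p q where e: "e = (p, q)" by fastforce
  have f: "f p = q" "f q = p" and new: "(p, q) \<notin> set es" "(q, p) \<notin> set es"
    using Cons.prems(1) Cons.prems(2)[of p q] e by auto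
  have pairs: "f u = v \<and> f v = u" if "(u, v) \<in> set es" for u v
    using Cons.prems(2)[of u v] that by simp
  have "distinct es" using Cons.prems(1) by simp
  moreover have "f u = v \<and> f v = u \<and> (v, u) \<notin> set es" if "(u, v) \<in> set es" for u v
    using Cons.prems(2)[of u v] that by simp
  ultimately have IH: "transposition_product es x =
      (if x \<in> fst ` set es \<or> x \<in> snd ` set es then f x else x)"
    by (rule Cons.IH)
  have step: "transposition_product (e # es) x = Transposition.transpose p q (transposition_product es x)"
    by (simp add: transposition_product_def e)
  show ?case
  proof (cases "x \<in> fst ` set es \<or> x \<in> snd ` set es")
    case True
    then obtain y where y: "(x, y) \<in> set es \<or> (y, x) \<in> set es" by force
    then have fx: "f x = y" "f y = x" using pairs by blast+
    have "y \<noteq> p" using y fx f new by metis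
    moreover have "y \<noteq> q" using y fx f new by metis
    moreover have "transposition_product es x = y" using IH True fx by simp
    moreover have c: "x \<in> fst ` set (e # es) \<or> x \<in> snd ` set (e # es)" using True by auto
    ultimately show ?thesis unfolding step if_P[OF c] using fx by simp
  next
    case False
    then show ?thesis using IH step f e by (auto simp: transpose_def)
  qed
qed

section \<open>The greedy flip computes the relational one\<close>

lemma orthogonal_mono:
  "orthogonal G D U \<Longrightarrow> D' \<subseteq> D \<Longrightarrow> U' \<subseteq> U \<Longrightarrow> orthogonal G D' U'"
  unfolding orthogonal_def independent_def by blast

text \<open>Loop invariant of the scan. \<open>T\<close> is the intended result; after the prefix
  \<open>ys\<close> exactly the members of \<open>T\<close> in \<open>ys\<close> have been added, so
  the hypothesis is the greedy test at that moment.\<close>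

lemma greedy_D_eq:
  assumes "\<And>ys x zs. xs = ys @ x # zs \<Longrightarrow> orthogonal G (insert x (D \<union> (T \<inter> set ys))) U \<longleftrightarrow> x \<in> T"
  shows "greedy_D G U D xs = D \<union> (T \<inter> set xs)"
  using assms
proof (induction xs arbitrary: D)
  case (Cons x xs)
  define D' where "D' = D \<union> (T \<inter> {x})"
  have "orthogonal G (insert x D) U \<longleftrightarrow> x \<in> T" using Cons.prems[of "[]" x xs] by simp
  then have "greedy_D G U D (x # xs) = greedy_D G U D' xs" by (auto simp: D'_def)
  also have "\<dots> = D' \<union> (T \<inter> set xs)"
  proof (rule Cons.IH)
    fix ys y zs assume "xs = ys @ y # zs"
    moreover have "D' \<union> (T \<inter> set ys) = D \<union> (T \<inter> set (x # ys))" by (auto simp: D'_def)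
    ultimately show "orthogonal G (insert y (D' \<union> (T \<inter> set ys))) U \<longleftrightarrow> y \<in> T"
      using Cons.prems[of "x # ys" y zs] by simp
  qed
  finally show ?case by (auto simp: D'_def)
qed simp

lemma greedy_U_eq:
  assumes "\<And>ys x zs. xs = ys @ x # zs \<Longrightarrow> orthogonal G D (insert x (U \<union> (T \<inter> set ys))) \<longleftrightarrow> x \<in> T"
  shows "greedy_U G D U xs = U \<union> (T \<inter> set xs)"
  using assms
proof (induction xs arbitrary: U)
  case (Cons x xs)
  define U' where "U' = U \<union> (T \<inter> {x})"
  have "orthogonal G D (insert x U) \<longleftrightarrow> x \<in> T" using Cons.prems[of "[]" x xs] by simp
  then have "greedy_U G D U (x # xs) = greedy_U G D U' xs" by (auto simp: U'_def)
  also have "\<dots> = U' \<union> (T \<inter> set xs)"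
  proof (rule Cons.IH)
    fix ys y zs assume "xs = ys @ y # zs"
    moreover have "U' \<union> (T \<inter> set ys) = U \<union> (T \<inter> set (x # ys))" by (auto simp: U'_def)
    ultimately show "orthogonal G D (insert y (U' \<union> (T \<inter> set ys))) \<longleftrightarrow> y \<in> T"
      using Cons.prems[of "x # ys" y zs] by simp
  qed
  finally show ?case by (auto simp: U'_def)
qed simp

lemma orthogonal_iff:
  "orthogonal G D U \<longleftrightarrow> D \<subseteq> verts G \<and> U \<subseteq> verts G \<and> D \<inter> U = {} \<and>
    (\<forall>x\<in>D. \<forall>y\<in>D. (x, y) \<notin> arcs_ends G) \<and> (\<forall>x\<in>U. \<forall>y\<in>U. (x, y) \<notin> arcs_ends G) \<and>
    (\<forall>x\<in>D. \<forall>y\<in>U. (x, y) \<notin> arcs_ends G)"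
  unfolding orthogonal_def independent_def by blast

locale acyclic_digraph = digraph G for G :: "('a, 'b) pre_digraph" +
  assumes acyclic_arcs: "acyclic (arcs_ends G)"
begin

sublocale dag "arcs_ends G"
  using acyclic_arcs finite_arcs by unfold_locales (auto simp: arcs_ends_def)

lemma G_less_iff: "G_less G x y \<longleftrightarrow> (y, x) \<in> (arcs_ends G)\<^sup>+"
proof -
  have "y \<rightarrow>\<^sup>*\<^bsub>G\<^esub> x \<and> x \<noteq> y \<longleftrightarrow> y \<rightarrow>\<^sup>+\<^bsub>G\<^esub> x"
    using reachable_neq_reachable1[of y x] reachable1_reachable[of y x] trancl_irrefl[of x] by auto
  then show ?thesis by (simp add: G_less_def G_order_def)
qed

lemma tpairs_orthogonal: "p \<in> tpairs (arcs_ends G) (verts G) \<Longrightarrow> orthogonal G (fst p) (snd p)"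
  by (simp add: tpairs_iff orthogonal_iff)

text \<open>An uncovered \<open>x\<close> could be put into \<open>U\<close> in place of all its
  predecessors there, which are larger. This is where several elements have to be replaced at once;
  with none to replace, \<open>x\<close> is simply added.\<close>

lemma tight_cover:
  assumes tight: "tight G D U" and x: "x \<in> verts G"
  shows "x \<in> D \<or> x \<in> U \<or> (\<exists>d\<in>D. (d, x) \<in> arcs_ends G) \<or> (\<exists>u\<in>U. (x, u) \<in> arcs_ends G)"
proof (rule ccontr)
  assume "\<not> ?thesis"
  then have no: "x \<notin> D" "x \<notin> U" "\<And>d. d \<in> D \<Longrightarrow> (d, x) \<notin> arcs_ends G"
    "\<And>u. u \<in> U \<Longrightarrow> (x, u) \<notin> arcs_ends G" by auto
  have orth: "orthogonal G D U" using tight by (simp add: tight_def)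
  define S where "S = {u\<in>U. (u, x) \<in> arcs_ends G}"
  have loop: "(x, x) \<notin> arcs_ends G" using trancl_irrefl by blast
  have orth': "orthogonal G D (insert x (U - S))"
    using orth no loop x unfolding orthogonal_iff S_def by blast
  show False
  proof (cases "S = {}")
    case True
    then show False using orth' tight no x by (auto simp: tight_def)
  next
    case False
    have "G_less G x u" if "u \<in> S" for u
      using that by (auto simp: G_less_iff S_def)
    then have "decrease G U (insert x (U - S))"
      unfolding decrease_def using False no x by (intro exI[of _ S] exI[of _ x]) (auto simp: S_def)
    then show False using orth' tight by (auto simp: tight_def)
  qed
qed

text \<open>For the converse direction, a vertex \<open>x\<close> to be inserted is blocked by some
  \<open>d\<close> above it or some \<open>u\<close> below it. An increase discards only elements
  below \<open>x\<close> and so keeps \<open>d\<close>; a decrease discards only elements above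
  \<open>x\<close> and so keeps \<open>u\<close>.\<close>

lemma top_pairs_eq: "top_pairs G = tpairs (arcs_ends G) (verts G)"
proof -
  have "tight G D U \<longleftrightarrow> (D, U) \<in> tpairs (arcs_ends G) (verts G)" for D U
  proof
    assume tight: "tight G D U"
    then have "orthogonal G D U" by (simp add: tight_def)
    then show "(D, U) \<in> tpairs (arcs_ends G) (verts G)"
      using tight_cover[OF tight] unfolding tpairs_iff orthogonal_iff fst_conv snd_conv by blast
  next
    assume DU: "(D, U) \<in> tpairs (arcs_ends G) (verts G)"
    have cover: "(\<exists>d\<in>D. (d, x) \<in> arcs_ends G) \<or> (\<exists>u\<in>U. (x, u) \<in> arcs_ends G)"
      if "x \<in> verts G" "x \<notin> D" "x \<notin> U" for x
      using DU that unfolding tpairs_iff fst_conv snd_conv by blast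
    have inc: "\<not> orthogonal G D' U" if D': "increase G D D'" for D'
    proof
      assume orth: "orthogonal G D' U"
      obtain S x where S: "S \<subseteq> D" "x \<in> verts G" "x \<notin> D" "\<And>s. s \<in> S \<Longrightarrow> G_less G s x"
        "D' = insert x (D - S)"
        using D' unfolding increase_def by blast
      have "x \<notin> U" "\<forall>u\<in>U. (x, u) \<notin> arcs_ends G"
        using orth S(5) unfolding orthogonal_iff by blast+
      then obtain d where d: "d \<in> D" "(d, x) \<in> arcs_ends G" using cover S(2,3) by blast
      have "d \<notin> S"
        using S(4)[of d] trancl_asym[of x d] d(2) by (auto simp: G_less_iff)
      then show False using orth d S(5) unfolding orthogonal_iff by blast
    qed
    have dec: "\<not> orthogonal G D U'" if U': "decrease G U U'" for U'
    proof
      assume orth: "orthogonal G D U'"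
      obtain S x where S: "S \<subseteq> U" "x \<in> verts G" "x \<notin> U" "\<And>s. s \<in> S \<Longrightarrow> G_less G x s"
        "U' = insert x (U - S)"
        using U' unfolding decrease_def by blast
      have "x \<notin> D" "\<forall>d\<in>D. (d, x) \<notin> arcs_ends G"
        using orth S(5) unfolding orthogonal_iff by blast+
      then obtain u where u: "u \<in> U" "(x, u) \<in> arcs_ends G" using cover S(2,3) by blast
      have "u \<notin> S"
        using S(4)[of u] trancl_asym[of u x] u(2) by (auto simp: G_less_iff)
      then show False using orth u S(5) unfolding orthogonal_iff by blast
    qed
    have "\<not> orthogonal G (insert x D) U" if "x \<in> verts G" "x \<notin> D" for x
      using cover[OF that] unfolding orthogonal_iff by blast
    moreover have "\<not> orthogonal G D (insert x U)" if "x \<in> verts G" "x \<notin> U" for x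
      using cover[of x] that unfolding orthogonal_iff by blast
    ultimately show "tight G D U"
      using tpairs_orthogonal[OF DU] inc dec by (simp add: tight_def)
  qed
  then show ?thesis by (auto simp: top_pairs_def)
qed

end

locale ordered_digraph = acyclic_digraph G for G :: "('a, 'b) pre_digraph" +
  fixes l l' :: "'a list"
  assumes lin_ext: "linear_extension_pair G l l'"
begin

abbreviation "E \<equiv> arcs_ends G"
abbreviation "V \<equiv> verts G"

lemma arcs_in_verts: "E \<subseteq> V \<times> V"
  by (auto dest: adj_in_verts)

text \<open>Erasing the regions that a flip at \<open>g\<close> refills loses nothing: whatever
  blocks a vertex \<open>x\<close> outside the original set is either still present or has been
  scanned before \<open>x\<close>, so each greedy test succeeds exactly on the original
  members.\<close>

lemma complete_pair_tight:
  assumes p: "p \<in> tpairs E V"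
  shows "complete_pair G l l' g ({x\<in>fst p. \<not> G_less G x g}, {x\<in>snd p. \<not> G_less G g x}) = p"
proof -
  obtain D U where DU: "p = (D, U)" by fastforce
  define D0 where "D0 = {x\<in>D. \<not> G_less G x g}"
  define U0 where "U0 = {x\<in>U. \<not> G_less G g x}"
  define xs where "xs = filter (\<lambda>x. G_less G x g) l'"
  define us where "us = filter (\<lambda>x. G_less G g x) l"
  have DV: "D \<subseteq> V" "U \<subseteq> V" using tpairs_subset[OF p] DU by auto
  have orth: "orthogonal G D U" using tpairs_orthogonal[OF p] DU by simp
  have loop: "(x, x) \<notin> E" for x using trancl_irrefl by blast
  have set_xs: "set xs = {x\<in>V. G_less G x g}" and set_us: "set us = {x\<in>V. G_less G g x}"
    using lin_ext by (auto simp: xs_def us_def linear_extension_pair_def linear_extension_def)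
  have sorted_xs: "sorted_wrt (\<lambda>x y. \<not> y \<rightarrow>\<^sup>*\<^bsub>G\<^esub> x) xs" and sorted_us: "sorted_wrt (\<lambda>x y. \<not> x \<rightarrow>\<^sup>*\<^bsub>G\<^esub> y) us"
    using lin_ext unfolding xs_def us_def
    by (auto simp: linear_extension_pair_def linear_extension_def G_order_def intro: sorted_wrt_filter)
  have "greedy_D G U0 D0 xs = D0 \<union> (D \<inter> set xs)"
  proof (rule greedy_D_eq)
    fix ys x zs assume xs: "xs = ys @ x # zs"
    have x: "x \<in> V" "G_less G x g" using set_xs xs by auto
    show "orthogonal G (insert x (D0 \<union> (D \<inter> set ys))) U0 \<longleftrightarrow> x \<in> D"
    proof
      show "orthogonal G (insert x (D0 \<union> (D \<inter> set ys))) U0" if "x \<in> D"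
        using orth by (rule orthogonal_mono) (use that in \<open>auto simp: D0_def U0_def\<close>)
    next
      assume o: "orthogonal G (insert x (D0 \<union> (D \<inter> set ys))) U0"
      show "x \<in> D"
      proof (rule ccontr)
        assume xD: "x \<notin> D"
        \<comment> \<open>The test only sees the truncated \<open>U0\<close>, but for
          \<open>x\<close> below \<open>g\<close> the relevant elements of \<open>U\<close> are
          below \<open>g\<close> as well and were not erased.\<close>
        have above: "u \<in> U0" if "u \<in> U" "u = x \<or> (x, u) \<in> E" for u
        proof -
          have "(g, u) \<in> E\<^sup>+" using x(2) that(2) by (auto simp: G_less_iff)
          then have "(u, g) \<notin> E\<^sup>+" using trancl_asym trancl_into_rtrancl by metis
          then show ?thesis using that(1) by (simp add: U0_def G_less_iff)
        qed
        have "x \<notin> U" using above[of x] o unfolding orthogonal_iff by blast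
        then consider d where "d \<in> D" "(d, x) \<in> E" | u where "u \<in> U" "(x, u) \<in> E"
          using tpairs_cover[OF p x(1)] xD DU by auto
        then show False
        proof cases
          case (1 d)
          have "d \<in> D0 \<union> (D \<inter> set ys)"
          proof (cases "G_less G d g")
            case True
            then have "d \<in> set xs" using set_xs DV 1 by blast
            moreover have "d \<noteq> x" using loop 1 by blast
            \<comment> \<open>\<open>l'\<close> runs downwards, so a predecessor of \<open>x\<close>
              cannot come after it.\<close>
            moreover have "d \<notin> set zs"
              using sorted_xs 1(2) unfolding xs by (auto simp: sorted_wrt_append)
            ultimately show ?thesis using xs 1 by auto
          qed (use 1 in \<open>simp add: D0_def\<close>)
          then show False using o 1(2) unfolding orthogonal_iff by blast
        next
          case (2 u)
          then show False using above[of u] o unfolding orthogonal_iff by blast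
        qed
      qed
    qed
  qed
  also have "D0 \<union> (D \<inter> set xs) = D" using DV by (auto simp: D0_def set_xs)
  finally have gD: "greedy_D G U0 D0 xs = D" .
  have "greedy_U G D U0 us = U0 \<union> (U \<inter> set us)"
  proof (rule greedy_U_eq)
    fix ys x zs assume us: "us = ys @ x # zs"
    have x: "x \<in> V" "G_less G g x" using set_us us by auto
    show "orthogonal G D (insert x (U0 \<union> (U \<inter> set ys))) \<longleftrightarrow> x \<in> U"
    proof
      show "orthogonal G D (insert x (U0 \<union> (U \<inter> set ys)))" if "x \<in> U"
        using orth by (rule orthogonal_mono) (use that in \<open>auto simp: U0_def\<close>)
    next
      assume o: "orthogonal G D (insert x (U0 \<union> (U \<inter> set ys)))"
      show "x \<in> U"
      proof (rule ccontr)
        assume xU: "x \<notin> U"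
        have "x \<notin> D" using o unfolding orthogonal_iff by blast
        then consider d where "d \<in> D" "(d, x) \<in> E" | u where "u \<in> U" "(x, u) \<in> E"
          using tpairs_cover[OF p x(1)] xU DU by auto
        then show False
        proof cases
          case (1 d)
          then show False using o unfolding orthogonal_iff by blast
        next
          case (2 u)
          have "u \<in> U0 \<union> (U \<inter> set ys)"
          proof (cases "G_less G g u")
            case True
            then have "u \<in> set us" using set_us DV 2 by blast
            moreover have "u \<noteq> x" using loop 2 by blast
            moreover have "u \<notin> set zs"
              using sorted_us 2(2) unfolding us by (auto simp: sorted_wrt_append)
            ultimately show ?thesis using us 2 by auto
          qed (use 2 in \<open>simp add: U0_def\<close>)
          then show False using o 2(2) unfolding orthogonal_iff by blast
        qed
      qed
    qed
  qed
  also have "U0 \<union> (U \<inter> set us) = U" using DV by (auto simp: U0_def set_us)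
  finally have gU: "greedy_U G D U0 us = U" .
  show ?thesis
    using gD gU by (simp add: complete_pair_def DU D0_def U0_def xs_def us_def)
qed

text \<open>The pair handed to the completion is the truncation of the relational target
  \<open>q\<close>, which differs from that of \<open>p\<close> only at \<open>g\<close>; completing
  it restores \<open>q\<close>. In particular all linear extensions give the same flips.\<close>

lemma flip_eq_flip_perm:
  assumes p: "p \<in> tpairs E V"
  shows "flip G l l' g p = flip_perm E V g p"
  using finite_verts p
proof (cases rule: flip_perm_cases[where g = g])
  case 1
  define q where "q = flip_perm E V g p"
  have rel: "flip_related E V g p q" using 1 by (simp add: q_def)
  have q: "q \<in> tpairs E V" using rel by (simp add: flip_related_def)
  have fst_eq: "x \<in> fst q \<longleftrightarrow> x \<in> fst p" if "\<not> G_less G x g" "x \<noteq> g" for x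
    using rel that rtranclD[of g x E] unfolding flip_related_def up_flip_def G_less_iff by blast
  have snd_eq: "x \<in> snd q \<longleftrightarrow> x \<in> snd p" if "\<not> G_less G g x" "x \<noteq> g" for x
    using rel that rtranclD[of x g E] unfolding flip_related_def up_flip_def G_less_iff by blast
  have gg: "\<not> G_less G g g" by (simp add: G_less_def)
  consider "g \<in> snd p" "g \<in> fst q" "g \<notin> fst p" "g \<notin> snd q"
    | "g \<in> fst p" "g \<in> snd q" "g \<notin> snd p" "g \<notin> fst q"
    using rel tpairs_disjoint[OF p] tpairs_disjoint[OF q] unfolding flip_related_def up_flip_def by blast
  then have "flip G l l' g p =
    complete_pair G l l' g ({x\<in>fst q. \<not> G_less G x g}, {x\<in>snd q. \<not> G_less G g x})"
  proof cases
    case 1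
    have "insert g {x\<in>fst p. \<not> G_less G x g} = {x\<in>fst q. \<not> G_less G x g}"
      "{x\<in>snd p. \<not> G_less G g x} - {g} = {x\<in>snd q. \<not> G_less G g x}"
      using 1 fst_eq snd_eq gg by blast+
    then show ?thesis using 1 by (simp add: flip_def case_prod_beta Let_def)
  next
    case 2
    have "{x\<in>fst p. \<not> G_less G x g} - {g} = {x\<in>fst q. \<not> G_less G x g}"
      "insert g {x\<in>snd p. \<not> G_less G g x} = {x\<in>snd q. \<not> G_less G g x}"
      using 2 fst_eq snd_eq gg by blast+
    then show ?thesis using 2 by (simp add: flip_def case_prod_beta Let_def)
  qed
  then show ?thesis using complete_pair_tight[OF q] by (simp add: q_def)
next
  case 2
  then show ?thesis by (simp add: flip_def case_prod_beta)
qed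

lemma flip_step_eq: "flip_step G l l' = up_step E V"
proof -
  have eq: "g \<in> snd p \<and> flip G l l' g p = q \<longleftrightarrow> up_flip E g p q"
    if pq: "p \<in> tpairs E V" "q \<in> tpairs E V" for p q g
  proof
    assume R: "g \<in> snd p \<and> flip G l l' g p = q"
    then have "flip_related E V g p q"
      using flip_perm_related[OF finite_verts pq(1), of g] flip_eq_flip_perm[OF pq(1)] by simp
    then show "up_flip E g p q"
      using R tpairs_disjoint[OF pq(1)] unfolding flip_related_def up_flip_def by blast
  next
    assume up: "up_flip E g p q"
    then have "flip_related E V g p q" using pq by (simp add: flip_related_def)
    from flip_perm_eqI[OF this] show "g \<in> snd p \<and> flip G l l' g p = q"
      using up flip_eq_flip_perm[OF pq(1)] by (simp add: up_flip_def)
  qed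
  have "(p, q) \<in> flip_step G l l' \<longleftrightarrow> (p, q) \<in> up_step E V" for p q
    unfolding flip_step_def up_step_def top_pairs_eq mem_Collect_eq prod.case using eq by blast
  then show ?thesis by auto
qed

lemma hasse_edges_eq:
  "hasse_edges G l l' g = {(p, q). p \<in> tpairs E V \<and> q \<in> tpairs E V \<and> up_flip E g p q}"
proof -
  have "(p, q) \<in> hasse_edges G l l' g \<longleftrightarrow>
    covers ((up_step E V)\<^sup>* \<inter> tpairs E V \<times> tpairs E V) p q \<and> flip_perm E V g p = q" for p q
  proof -
    have "covers ((up_step E V)\<^sup>* \<inter> tpairs E V \<times> tpairs E V) p q \<Longrightarrow> p \<in> tpairs E V"
      by (auto simp: covers_def)
    then show ?thesis
      using flip_eq_flip_perm[of p g]
      by (auto simp: hasse_edges_def indep_poset_def flip_step_eq top_pairs_eq)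
  qed
  then show ?thesis unfolding covers_up_step_iff by auto
qed

lemma transposition_product_hasse_edges:
  assumes "distinct es" "set es = hasse_edges G l l' g"
  shows "transposition_product es = flip_perm E V g"
proof
  fix x
  have es: "(p, q) \<in> set es \<longleftrightarrow> p \<in> tpairs E V \<and> q \<in> tpairs E V \<and> up_flip E g p q" for p q
    unfolding assms(2) hasse_edges_eq by simp
  have "flip_perm E V g p = q \<and> flip_perm E V g q = p \<and> (q, p) \<notin> set es" if "(p, q) \<in> set es" for p q
  proof -
    have rel: "flip_related E V g p q" using that es by (simp add: flip_related_def)
    have "p \<in> tpairs E V" "g \<in> snd p" using that es unfolding up_flip_def by blast+
    then have "\<not> up_flip E g q p" using tpairs_disjoint[of p E V g] unfolding up_flip_def by blast
    then show ?thesis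
      using flip_perm_eqI[OF rel] flip_perm_eqI[OF flip_related_sym[OF rel]] es by blast
  qed
  note product = transposition_product_apply[OF assms(1), of "flip_perm E V g", OF this]
  show "transposition_product es x = flip_perm E V g x"
  proof (cases "\<exists>q. flip_related E V g x q")
    case True
    then obtain q where "(x, q) \<in> set es \<or> (q, x) \<in> set es"
      using es unfolding flip_related_def by blast
    then have "x \<in> fst ` set es \<or> x \<in> snd ` set es" by force
    then show ?thesis using product by simp
  next
    case False
    then have "flip_perm E V g x = x" by (simp add: flip_perm_def)
    then show ?thesis using product by simp
  qed
qed

lemma label_perms_eq: "label_perms G l l' = flip_perm E V ` V"
proof (intro subset_antisym subsetI)
  fix f assume "f \<in> label_perms G l l'"
  then obtain g es where "f = transposition_product es" "g \<in> V" "distinct es"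
      "set es = hasse_edges G l l' g"
    unfolding label_perms_def by blast
  then show "f \<in> flip_perm E V ` V" using transposition_product_hasse_edges[of es g] by blast
next
  fix f assume "f \<in> flip_perm E V ` V"
  then obtain g where g: "g \<in> V" "f = flip_perm E V g" by blast
  have "(g, g) \<notin> E" using trancl_irrefl by blast
  \<comment> \<open>Every vertex occurs as a label: a tight pair with second component
    \<open>{g}\<close> can be flipped at \<open>g\<close>.\<close>
  then obtain p where p: "p \<in> tpairs E V" "snd p = {g}"
    using tpairs_snd_exists[of V "{g}"] g by auto
  then obtain q where "q \<in> tpairs E V" "up_flip E g p q"
    using up_flip_exists[OF finite_verts p(1), of g] by auto
  then have "(p, q) \<in> hasse_edges G l l' g" using p(1) by (simp add: hasse_edges_eq)
  then have "hasse_edges G l l' g \<noteq> {}" by blast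
  moreover have "finite (hasse_edges G l l' g)"
    by (rule finite_subset[of _ "tpairs E V \<times> tpairs E V"])
      (auto simp: hasse_edges_eq finite_tpairs)
  then obtain es where es: "set es = hasse_edges G l l' g" "distinct es"
    using finite_distinct_list[of "hasse_edges G l l' g"] by metis
  moreover have "f = transposition_product es"
    using transposition_product_hasse_edges[OF es(2,1)] g by simp
  ultimately show "f \<in> label_perms G l l'"
    unfolding label_perms_def using g by blast
qed

end

section \<open>The generated group as a set of words\<close>

definition perm_monoid :: "('c \<Rightarrow> 'c) set \<Rightarrow> ('c \<Rightarrow> 'c) monoid" where
  "perm_monoid H = \<lparr>carrier = H, mult = (\<circ>), one = id\<rparr>"

lemma perm_monoid_simps [simp]:
  "carrier (perm_monoid H) = H" "mult (perm_monoid H) = (\<circ>)" "one (perm_monoid H) = id"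
  by (simp_all add: perm_monoid_def)

lemma (in perm_closed) group_perm_monoid: "group (perm_monoid H)"
proof (rule groupI)
  fix f assume f: "f \<in> carrier (perm_monoid H)"
  then have "Hilbert_Choice.inv f \<circ> f = id" using bij_closed by (simp add: bij_is_inj)
  then show "\<exists>g\<in>carrier (perm_monoid H). g \<otimes>\<^bsub>perm_monoid H\<^esub> f = \<one>\<^bsub>perm_monoid H\<^esub>"
    using f inv_closed by (intro bexI[of _ "Hilbert_Choice.inv f"]) simp_all
qed (auto simp: comp_closed id_closed comp_assoc)

lemma perm_closed_permutes: "perm_closed {\<sigma>. \<sigma> permutes P}"
  by unfold_locales (auto intro: permutes_compose permutes_inv permutes_id permutes_bij)

lemma sym_group_on_eq: "sym_group_on P = perm_monoid {\<sigma>. \<sigma> permutes P}"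
  by (simp add: sym_group_on_def perm_monoid_def)

lemma generate_eq_words:
  assumes "\<And>f. f \<in> F \<Longrightarrow> f permutes P" "\<And>f. f \<in> F \<Longrightarrow> f \<circ> f = id"
  shows "generate (sym_group_on P) F = words F"
proof -
  have sym: "one (sym_group_on P) = id" "mult (sym_group_on P) = (\<circ>)"
    by (simp_all add: sym_group_on_def)
  show ?thesis
  proof (intro subset_antisym subsetI)
    interpret group "sym_group_on P"
      unfolding sym_group_on_eq by (rule perm_closed.group_perm_monoid[OF perm_closed_permutes])
    fix w
    show "w \<in> words F" if "w \<in> generate (sym_group_on P) F"
      using that
    proof (induction w rule: generate.induct)
      case one
      show ?case unfolding sym_group_on_def monoid.simps by (rule words.words_id)
    next
      case (incl h)
      then show ?case by (rule words_incl)
    next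
      case (inv h)
      then have "m_inv (sym_group_on P) h = h"
        by (intro inv_equality) (use assms in \<open>auto simp: sym_group_on_def\<close>)
      then show ?case using words_incl[OF inv] by simp
    next
      case (eng v w)
      then show ?case using words_comp[OF eng.IH] by (simp only: sym_group_on_def monoid.simps)
    qed
  next
    fix w
    show "w \<in> generate (sym_group_on P) F" if "w \<in> words F"
      using that
    proof (induction w)
      case words_id
      show ?case using generate.one[of "sym_group_on P" F] by (simp only: sym)
    next
      case (words_step f w)
      then show ?case
        using generate.eng[OF generate.incl[of f F "sym_group_on P"], of w] by (simp only: sym)
    qed
  qed
qed

lemma (in ordered_digraph) flip_group_eq: "flip_group G l l' = perm_monoid (flip_words E V)"
proof -
  have "carrier (sym_group_on (top_pairs G)) \<inter> label_perms G l l' = flip_perm E V ` V"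
    unfolding label_perms_eq top_pairs_eq using flip_perm_permutes by (auto simp: sym_group_on_def)
  then have "flip_group G l l' = sym_group_on (tpairs E V)
      \<lparr>carrier := generate (sym_group_on (tpairs E V)) (flip_perm E V ` V)\<rparr>"
    by (simp add: flip_group_def subgroup_generated_def top_pairs_eq)
  also have "generate (sym_group_on (tpairs E V)) (flip_perm E V ` V) = flip_words E V"
    unfolding flip_words_def
    by (rule generate_eq_words) (auto simp: flip_perm_permutes fun_eq_iff flip_perm_involution)
  finally show ?thesis by (simp add: sym_group_on_def perm_monoid_def)
qed

section \<open>Flip groups of disjoint unions\<close>

definition restrict_pair :: "'a set \<Rightarrow> 'a set_pair \<Rightarrow> 'a set_pair" where
  "restrict_pair A p = (fst p \<inter> A, snd p \<inter> A)"

locale dag_parts = dag E for E :: "('a \<times> 'a) set" +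
  fixes I :: "'i set" and W :: "'i \<Rightarrow> 'a set"
  assumes finite_I: "finite I" and finite_W: "i \<in> I \<Longrightarrow> finite (W i)"
    and disjoint_W: "i \<in> I \<Longrightarrow> j \<in> I \<Longrightarrow> i \<noteq> j \<Longrightarrow> W i \<inter> W j = {}"
    and closed_W: "i \<in> I \<Longrightarrow> (x, y) \<in> E \<Longrightarrow> x \<in> W i \<longleftrightarrow> y \<in> W i"
begin

definition union_W :: "'a set" where
  "union_W = (\<Union>i\<in>I. W i)"

definition glue :: "('i \<Rightarrow> 'a set_pair) \<Rightarrow> 'a set_pair" where
  "glue f = (\<Union>i\<in>I. fst (f i), \<Union>i\<in>I. snd (f i))"

text \<open>The identity off the tight pairs, as for \<open>flip_perm\<close>, so that glued maps
  and flip words can be equal as functions.\<close>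

definition glue_perm :: "('i \<Rightarrow> 'a set_pair \<Rightarrow> 'a set_pair) \<Rightarrow> 'a set_pair \<Rightarrow> 'a set_pair" where
  "glue_perm \<sigma> p = (if p \<in> tpairs E union_W then glue (\<lambda>i. \<sigma> i (restrict_pair (W i) p)) else p)"

lemma finite_union_W: "finite union_W"
  using finite_I finite_W by (simp add: union_W_def)

lemma rtrancl_closed_W:
  assumes "(x, y) \<in> E\<^sup>*" "i \<in> I"
  shows "x \<in> W i \<longleftrightarrow> y \<in> W i"
  using assms by (induction rule: rtrancl_induct) (auto simp: closed_W)

lemma restrict_pair_tpairs:
  assumes p: "p \<in> tpairs E union_W" and i: "i \<in> I"
  shows "restrict_pair (W i) p \<in> tpairs E (W i)"
proof -
  have "x \<in> fst p \<inter> W i \<or> x \<in> snd p \<inter> W i \<or> (\<exists>d\<in>fst p \<inter> W i. (d, x) \<in> E) \<or>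
      (\<exists>u\<in>snd p \<inter> W i. (x, u) \<in> E)" if x: "x \<in> W i" for x
  proof -
    have "x \<in> union_W" using x i by (auto simp: union_W_def)
    then consider "x \<in> fst p" | "x \<in> snd p" | d where "d \<in> fst p" "(d, x) \<in> E"
      | u where "u \<in> snd p" "(x, u) \<in> E"
      using tpairs_cover[OF p] by auto
    then show ?thesis using closed_W[OF i] x by cases blast+
  qed
  then show ?thesis
    using p unfolding tpairs_iff restrict_pair_def fst_conv snd_conv by blast
qed

lemma tpairs_parts_eqI:
  assumes p: "p \<in> tpairs E union_W" and q: "q \<in> tpairs E union_W"
    and eq: "\<And>i. i \<in> I \<Longrightarrow> restrict_pair (W i) p = restrict_pair (W i) q"
  shows "p = q"
proof -
  have mem: "x \<in> fst p \<longleftrightarrow> x \<in> fst q" "x \<in> snd p \<longleftrightarrow> x \<in> snd q" if "x \<in> W i" "i \<in> I" for x i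
    using eq[OF that(2)] that(1) by (auto simp: restrict_pair_def)
  have sub: "fst p \<subseteq> union_W" "fst q \<subseteq> union_W" "snd p \<subseteq> union_W" "snd q \<subseteq> union_W"
    using tpairs_subset[OF p] tpairs_subset[OF q] by auto
  show ?thesis
    using mem sub unfolding union_W_def by (intro prod_eqI set_eqI) blast+
qed

lemma glue_restrict:
  assumes f: "\<And>i. i \<in> I \<Longrightarrow> f i \<in> tpairs E (W i)" and i: "i \<in> I"
  shows "restrict_pair (W i) (glue f) = f i"
proof -
  have sub: "fst (f j) \<subseteq> W j" "snd (f j) \<subseteq> W j" if "j \<in> I" for j
    using tpairs_subset[OF f[OF that]] by auto
  have "x \<in> W j \<Longrightarrow> x \<in> W i \<Longrightarrow> j \<in> I \<Longrightarrow> j = i" for x j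
    using disjoint_W[OF _ i, of j] by blast
  then have "(\<Union>j\<in>I. fst (f j)) \<inter> W i = fst (f i)" "(\<Union>j\<in>I. snd (f j)) \<inter> W i = snd (f i)"
    using sub i by blast+
  then show ?thesis by (simp add: restrict_pair_def glue_def)
qed

lemma glue_tpairs:
  assumes f: "\<And>i. i \<in> I \<Longrightarrow> f i \<in> tpairs E (W i)"
  shows "glue f \<in> tpairs E union_W"
proof -
  define D where "D = fst (glue f)"
  define U where "U = snd (glue f)"
  have sub: "fst (f j) \<subseteq> W j" "snd (f j) \<subseteq> W j" if "j \<in> I" for j
    using tpairs_subset[OF f[OF that]] by auto
  have DU: "D \<inter> W i = fst (f i)" "U \<inter> W i = snd (f i)" if "i \<in> I" for i
    using arg_cong[OF glue_restrict[of f, OF f that], of fst]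
      arg_cong[OF glue_restrict[of f, OF f that], of snd]
    by (simp_all add: restrict_pair_def D_def U_def)
  have tot: "D \<subseteq> union_W" "U \<subseteq> union_W"
    using sub by (fastforce simp: D_def U_def glue_def union_W_def)+
  have "D \<inter> U = {}"
  proof -
    have "x \<notin> U" if x: "x \<in> D" for x
    proof -
      obtain i where i: "i \<in> I" "x \<in> W i" using x tot unfolding union_W_def by blast
      then show ?thesis using tpairs_disjoint[OF f[OF i(1)], of x] DU[OF i(1)] x by blast
    qed
    then show ?thesis by blast
  qed
  moreover have edge: "x \<in> U \<and> y \<in> D" if xy: "(x, y) \<in> E" "x \<in> D \<or> x \<in> U" "y \<in> D \<or> y \<in> U" for x y
  proof -
    obtain i where i: "i \<in> I" "x \<in> W i" using xy tot unfolding union_W_def by blast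
    then have "y \<in> W i" using closed_W xy by blast
    then show ?thesis using tpairs_no_edge[OF f[OF i(1)], of x y] DU[OF i(1)] xy i by blast
  qed
  moreover have "x \<in> D \<or> x \<in> U \<or> (\<exists>d\<in>D. (d, x) \<in> E) \<or> (\<exists>u\<in>U. (x, u) \<in> E)" if x: "x \<in> union_W" for x
  proof -
    obtain i where i: "i \<in> I" "x \<in> W i" using x unfolding union_W_def by blast
    consider "x \<in> fst (f i)" | "x \<in> snd (f i)" | d where "d \<in> fst (f i)" "(d, x) \<in> E"
      | u where "u \<in> snd (f i)" "(x, u) \<in> E"
      using tpairs_cover[OF f[OF i(1)] i(2)] by auto
    then show ?thesis using DU[OF i(1)] by cases blast+
  qed
  ultimately show ?thesis
    using tot unfolding tpairs_iff D_def[symmetric] U_def[symmetric] by blast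
qed

lemma flip_restrict_same:
  assumes i: "i \<in> I" and g: "g \<in> W i" and p: "p \<in> tpairs E union_W"
  shows "restrict_pair (W i) (flip_perm E union_W g p) = flip_perm E (W i) g (restrict_pair (W i) p)"
  using finite_union_W p
proof (cases rule: flip_perm_cases[where g = g])
  case 1
  define q where "q = flip_perm E union_W g p"
  have rel: "flip_related E union_W g p q" using 1 by (simp add: q_def)
  then have q: "q \<in> tpairs E union_W" by (simp add: flip_related_def)
  have "up_flip E g (restrict_pair (W i) a) (restrict_pair (W i) b)" if "up_flip E g a b" for a b
    using that g unfolding up_flip_def restrict_pair_def fst_conv snd_conv by blast
  then have "flip_related E (W i) g (restrict_pair (W i) p) (restrict_pair (W i) q)"
    using rel restrict_pair_tpairs[OF p i] restrict_pair_tpairs[OF q i]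
    unfolding flip_related_def by blast
  from flip_perm_eqI[OF this] show ?thesis by (simp add: q_def)
next
  case 2
  then show ?thesis
    using flip_perm_fixed[of g "restrict_pair (W i) p" "W i"] by (simp add: restrict_pair_def)
qed

text \<open>Comparable vertices lie in the same part, so all of the other part is among the data
  that a flip at \<open>g\<close> keeps.\<close>

lemma flip_restrict_other:
  assumes i: "i \<in> I" and j: "j \<in> I" "j \<noteq> i" and g: "g \<in> W i" and p: "p \<in> tpairs E union_W"
  shows "restrict_pair (W j) (flip_perm E union_W g p) = restrict_pair (W j) p"
  using finite_union_W p
proof (cases rule: flip_perm_cases[where g = g])
  case 1
  have "(g, x) \<notin> E\<^sup>*" "(x, g) \<notin> E\<^sup>*" if "x \<in> W j" for x
    using that disjoint_W[OF i j(1)] j(2) g rtrancl_closed_W[of g x] rtrancl_closed_W[of x g] i by blast+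
  then show ?thesis
    using 1 unfolding flip_related_def up_flip_def restrict_pair_def by blast
next
  case 2
  then show ?thesis by simp
qed

definition part_words :: "('i \<Rightarrow> 'a set_pair \<Rightarrow> 'a set_pair) \<Rightarrow> bool" where
  "part_words \<sigma> \<longleftrightarrow> (\<forall>i\<in>I. \<sigma> i \<in> flip_words E (W i))"

lemma part_words_in:
  assumes "part_words \<sigma>" "i \<in> I" "x \<in> tpairs E (W i)"
  shows "\<sigma> i x \<in> tpairs E (W i)"
proof -
  have "\<sigma> i permutes tpairs E (W i)"
    using assms(1,2) by (intro flip_words_permutes) (simp add: part_words_def)
  then show ?thesis using assms(3) by (simp add: permutes_in_image)
qed

lemma glue_perm_restrict:
  assumes \<sigma>: "part_words \<sigma>" and p: "p \<in> tpairs E union_W" and i: "i \<in> I"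
  shows "restrict_pair (W i) (glue_perm \<sigma> p) = \<sigma> i (restrict_pair (W i) p)"
  unfolding glue_perm_def using p
  by (simp add: glue_restrict[OF part_words_in[OF \<sigma>] i] restrict_pair_tpairs)

lemma glue_perm_tpairs:
  assumes \<sigma>: "part_words \<sigma>" and p: "p \<in> tpairs E union_W"
  shows "glue_perm \<sigma> p \<in> tpairs E union_W"
  unfolding glue_perm_def using p part_words_in[OF \<sigma>]
  by (simp add: glue_tpairs restrict_pair_tpairs)

lemma glue_perm_eqI:
  assumes \<sigma>: "part_words \<sigma>"
    and in_total: "\<And>p. p \<in> tpairs E union_W \<Longrightarrow> f p \<in> tpairs E union_W"
    and "\<And>p. p \<notin> tpairs E union_W \<Longrightarrow> f p = p"
    and "\<And>i p. p \<in> tpairs E union_W \<Longrightarrow> i \<in> I \<Longrightarrow>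
      restrict_pair (W i) (f p) = \<sigma> i (restrict_pair (W i) p)"
  shows "glue_perm \<sigma> = f"
proof
  fix p
  show "glue_perm \<sigma> p = f p"
  proof (cases "p \<in> tpairs E union_W")
    case True
    show ?thesis
      by (rule tpairs_parts_eqI) (use True assms glue_perm_restrict glue_perm_tpairs in auto)
  next
    case False
    then show ?thesis using assms(3) by (simp add: glue_perm_def)
  qed
qed

lemma glue_perm_cong: "(\<And>i. i \<in> I \<Longrightarrow> \<sigma> i = \<tau> i) \<Longrightarrow> glue_perm \<sigma> = glue_perm \<tau>"
  unfolding glue_perm_def glue_def by (intro ext) (simp cong: SUP_cong)

lemma part_words_comp: "part_words \<sigma> \<Longrightarrow> part_words \<tau> \<Longrightarrow> part_words (\<lambda>i. \<sigma> i \<circ> \<tau> i)"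
  using perm_closed.comp_closed[OF perm_closed_flip_words] by (simp add: part_words_def)

lemma id_in_flip_words: "id \<in> flip_words E A"
  unfolding flip_words_def by (rule words.words_id)

lemma glue_perm_comp:
  assumes \<sigma>: "part_words \<sigma>" and \<tau>: "part_words \<tau>"
  shows "glue_perm (\<lambda>i. \<sigma> i \<circ> \<tau> i) = glue_perm \<sigma> \<circ> glue_perm \<tau>"
proof (rule glue_perm_eqI[OF part_words_comp[OF \<sigma> \<tau>]])
  show "(glue_perm \<sigma> \<circ> glue_perm \<tau>) p \<in> tpairs E union_W" if "p \<in> tpairs E union_W" for p
    using that glue_perm_tpairs \<sigma> \<tau> by simp
  show "(glue_perm \<sigma> \<circ> glue_perm \<tau>) p = p" if "p \<notin> tpairs E union_W" for p
    using that by (simp add: glue_perm_def)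
  show "restrict_pair (W i) ((glue_perm \<sigma> \<circ> glue_perm \<tau>) p) = (\<sigma> i \<circ> \<tau> i) (restrict_pair (W i) p)"
    if "p \<in> tpairs E union_W" "i \<in> I" for i p
    using that glue_perm_tpairs[OF \<tau> that(1)] glue_perm_restrict \<sigma> \<tau> by simp
qed

definition single :: "'i \<Rightarrow> ('a set_pair \<Rightarrow> 'a set_pair) \<Rightarrow> 'i \<Rightarrow> 'a set_pair \<Rightarrow> 'a set_pair" where
  "single i w = (\<lambda>j. if j = i then w else id)"

lemma part_words_single: "w \<in> flip_words E (W i) \<Longrightarrow> part_words (single i w)"
  using id_in_flip_words by (simp add: part_words_def single_def)

lemma part_words_id: "part_words (\<lambda>i. id)"
  unfolding part_words_def using id_in_flip_words by blast

lemma glue_perm_id: "glue_perm (\<lambda>i. id) = id"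
  by (rule glue_perm_eqI[OF part_words_id]) simp_all

lemma glue_perm_single_flip:
  assumes i: "i \<in> I" and g: "g \<in> W i"
  shows "glue_perm (single i (flip_perm E (W i) g)) = flip_perm E union_W g"
proof (rule glue_perm_eqI)
  show "part_words (single i (flip_perm E (W i) g))"
    using flip_perm_in_words[OF g] by (rule part_words_single)
  show "restrict_pair (W j) (flip_perm E union_W g p)
      = single i (flip_perm E (W i) g) j (restrict_pair (W j) p)"
    if "p \<in> tpairs E union_W" "j \<in> I" for j p
    using flip_restrict_same[OF i g that(1)] flip_restrict_other[OF i that(2) _ g that(1)]
    by (simp add: single_def)
qed (simp_all add: flip_perm_in flip_perm_outside)

lemma glue_perm_single_in:
  assumes i: "i \<in> I" and w: "w \<in> flip_words E (W i)"
  shows "glue_perm (single i w) \<in> flip_words E union_W"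
  using w unfolding flip_words_def[of E "W i"]
proof (induction w)
  case words_id
  have eq: "single i id = (\<lambda>i. id)" by (auto simp: single_def)
  show ?case unfolding eq glue_perm_id by (rule id_in_flip_words)
next
  case (words_step f w)
  then obtain g where g: "g \<in> W i" "f = flip_perm E (W i) g" by blast
  have w: "w \<in> flip_words E (W i)" using words_step.hyps by (simp add: flip_words_def)
  have gt: "g \<in> union_W" using g i by (auto simp: union_W_def)
  have "glue_perm (single i (f \<circ> w)) = glue_perm (\<lambda>j. single i f j \<circ> single i w j)"
    by (rule glue_perm_cong) (simp add: single_def)
  also have "\<dots> = glue_perm (single i f) \<circ> glue_perm (single i w)"
    using part_words_single[OF flip_perm_in_words[OF g(1)]] part_words_single[OF w]
    unfolding g(2) by (rule glue_perm_comp)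
  also have "glue_perm (single i f) = flip_perm E union_W g"
    unfolding g(2) using i g(1) by (rule glue_perm_single_flip)
  finally show ?case
    using perm_closed.comp_closed[OF perm_closed_flip_words flip_perm_in_words[OF gt] words_step.IH]
    by (simp only:)
qed

lemma glue_perm_in:
  assumes \<sigma>: "part_words \<sigma>"
  shows "glue_perm \<sigma> \<in> flip_words E union_W"
proof -
  \<comment> \<open>The family is built up one part at a time: gluing is multiplicative, and a
    family concentrated on one part is lifted letter by letter.\<close>
  have "glue_perm (\<lambda>i. if i \<in> J then \<sigma> i else id) \<in> flip_words E union_W" if "finite J" "J \<subseteq> I" for J
    using that
  proof (induction J)
    case empty
    show ?case unfolding empty_iff if_False glue_perm_id by (rule id_in_flip_words)
  next
    case (insert j J)
    have j: "\<sigma> j \<in> flip_words E (W j)" and jI: "j \<in> I"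
      using insert.prems \<sigma> by (auto simp: part_words_def)
    have part: "part_words (\<lambda>i. if i \<in> J then \<sigma> i else id)"
      using \<sigma> id_in_flip_words by (simp add: part_words_def)
    have "glue_perm (\<lambda>i. if i \<in> insert j J then \<sigma> i else id)
        = glue_perm (\<lambda>i. single j (\<sigma> j) i \<circ> (if i \<in> J then \<sigma> i else id))"
      by (rule glue_perm_cong) (use insert.hyps in \<open>auto simp: single_def\<close>)
    also have "\<dots> = glue_perm (single j (\<sigma> j)) \<circ> glue_perm (\<lambda>i. if i \<in> J then \<sigma> i else id)"
      using part_words_single[OF j] part by (rule glue_perm_comp)
    moreover have "glue_perm (\<lambda>i. if i \<in> J then \<sigma> i else id) \<in> flip_words E union_W"
      using insert.IH insert.prems by blast
    ultimately show ?case
      using perm_closed.comp_closed[OF perm_closed_flip_words glue_perm_single_in[OF jI j]]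
      by (simp only:)
  qed
  from this[OF finite_I] have "glue_perm (\<lambda>i. if i \<in> I then \<sigma> i else id) \<in> flip_words E union_W"
    by simp
  also have "glue_perm (\<lambda>i. if i \<in> I then \<sigma> i else id) = glue_perm \<sigma>"
    by (rule glue_perm_cong) simp
  finally show ?thesis .
qed

lemma glue_perm_surj:
  assumes "w \<in> flip_words E union_W"
  shows "\<exists>\<sigma>. part_words \<sigma> \<and> glue_perm \<sigma> = w"
  using assms unfolding flip_words_def
proof (induction w)
  case words_id
  show ?case using part_words_id glue_perm_id by blast
next
  case (words_step f w)
  then obtain g where "g \<in> union_W" and f: "f = flip_perm E union_W g" by blast
  then obtain i where i: "i \<in> I" "g \<in> W i" unfolding union_W_def by blast
  obtain \<sigma> where \<sigma>: "part_words \<sigma>" "glue_perm \<sigma> = w" using words_step.IH by blast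
  have part: "part_words (single i (flip_perm E (W i) g))"
    using flip_perm_in_words[OF i(2)] by (rule part_words_single)
  show ?case
    using glue_perm_comp[OF part \<sigma>(1)] part_words_comp[OF part \<sigma>(1)]
    unfolding glue_perm_single_flip[OF i] \<sigma>(2) f[symmetric] by blast
qed

lemma glue_perm_inj:
  assumes \<sigma>: "part_words \<sigma>" and \<tau>: "part_words \<tau>" and eq: "glue_perm \<sigma> = glue_perm \<tau>"
    and i: "i \<in> I"
  shows "\<sigma> i = \<tau> i"
proof
  fix x
  have perm: "\<sigma> i permutes tpairs E (W i)" "\<tau> i permutes tpairs E (W i)"
    using \<sigma> \<tau> i flip_words_permutes by (auto simp: part_words_def)
  show "\<sigma> i x = \<tau> i x"
  proof (cases "x \<in> tpairs E (W i)")
    case True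
    \<comment> \<open>Every part has some tight pair, so \<open>x\<close> extends to a global pair
      on which the two glued maps can be compared.\<close>
    have "\<exists>y. y \<in> tpairs E (W j)" if "j \<in> I" for j
      using tpairs_fst_exists[OF finite_W[OF that], of "{}"] by auto
    then obtain y where y: "\<And>j. j \<in> I \<Longrightarrow> y j \<in> tpairs E (W j)" by metis
    define f where "f = y(i := x)"
    have f: "f j \<in> tpairs E (W j)" if "j \<in> I" for j using y that True by (simp add: f_def)
    have "restrict_pair (W i) (glue f) = x"
      using glue_restrict[of f, OF f i] by (simp add: f_def)
    then show ?thesis
      using glue_perm_restrict[OF \<sigma> glue_tpairs[of f, OF f] i]
        glue_perm_restrict[OF \<tau> glue_tpairs[of f, OF f] i] eq by simp
  next
    case False
    then show ?thesis using perm by (simp add: permutes_not_in)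
  qed
qed

text \<open>The isomorphism is built from the product side, by gluing families. Families in the
  product are extensional, which removes the freedom off \<open>I\<close> and makes gluing
  injective.\<close>

theorem flip_words_product:
  "perm_monoid (flip_words E union_W) \<cong> product_group I (\<lambda>i. perm_monoid (flip_words E (W i)))"
proof -
  let ?P = "product_group I (\<lambda>i. perm_monoid (flip_words E (W i)))"
  let ?G = "perm_monoid (flip_words E union_W)"
  have carr: "\<sigma> \<in> carrier ?P \<longleftrightarrow> part_words \<sigma> \<and> \<sigma> \<in> extensional I" for \<sigma>
    by (auto simp: part_words_def PiE_iff)
  have "glue_perm \<in> hom ?P ?G"
  proof (rule homI)
    fix \<sigma> assume "\<sigma> \<in> carrier ?P"
    then show "glue_perm \<sigma> \<in> carrier ?G" using carr glue_perm_in by simp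
  next
    fix \<sigma> \<tau> assume "\<sigma> \<in> carrier ?P" "\<tau> \<in> carrier ?P"
    then have st: "part_words \<sigma>" "part_words \<tau>" using carr by auto
    have "glue_perm (\<lambda>i\<in>I. \<sigma> i \<circ> \<tau> i) = glue_perm (\<lambda>i. \<sigma> i \<circ> \<tau> i)"
      by (rule glue_perm_cong) simp
    then show "glue_perm (\<sigma> \<otimes>\<^bsub>?P\<^esub> \<tau>) = glue_perm \<sigma> \<otimes>\<^bsub>?G\<^esub> glue_perm \<tau>"
      using glue_perm_comp[OF st] by simp
  qed
  moreover have "bij_betw glue_perm (carrier ?P) (carrier ?G)"
  proof (rule bij_betw_imageI)
    show "inj_on glue_perm (carrier ?P)"
    proof (rule inj_onI)
      fix \<sigma> \<tau> assume st: "\<sigma> \<in> carrier ?P" "\<tau> \<in> carrier ?P" "glue_perm \<sigma> = glue_perm \<tau>"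
      show "\<sigma> = \<tau>"
        by (rule extensionalityI[of _ I]) (use st carr glue_perm_inj in auto)
    qed
    show "glue_perm ` carrier ?P = carrier ?G"
    proof (intro subset_antisym subsetI)
      fix w assume "w \<in> glue_perm ` carrier ?P"
      then show "w \<in> carrier ?G" using carr glue_perm_in by auto
    next
      fix w assume "w \<in> carrier ?G"
      then obtain \<sigma> where \<sigma>: "part_words \<sigma>" "glue_perm \<sigma> = w"
        using glue_perm_surj by auto
      have "restrict \<sigma> I \<in> carrier ?P" using \<sigma>(1) carr by (simp add: part_words_def)
      moreover have "glue_perm (restrict \<sigma> I) = glue_perm \<sigma>" by (rule glue_perm_cong) simp
      ultimately show "w \<in> glue_perm ` carrier ?P" using \<sigma>(2) by (metis image_eqI)
    qed
  qed
  ultimately have "?P \<cong> ?G" by (auto simp: is_iso_def iso_def)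
  moreover have "group ?P"
    by (rule product_group) (rule perm_closed.group_perm_monoid[OF perm_closed_flip_words])
  ultimately show ?thesis by (rule group.iso_sym[rotated])
qed

end

section \<open>Connected components\<close>

lemma linked_mono: "linked E V \<Longrightarrow> E \<subseteq> E' \<Longrightarrow> linked E' V"
  unfolding linked_def by blast

context wf_digraph
begin

lemma connected_iff_linked: "Digraph_Component.connected G \<longleftrightarrow> linked (arcs_ends G) (verts G)"
proof -
  interpret S: pair_wf_digraph "mk_symmetric G" by (rule wellformed_mk_symmetric)
  define S where "S = parcs (mk_symmetric G)"
  have S: "(x, y) \<in> S \<longleftrightarrow> (x, y) \<in> arcs_ends G \<or> (y, x) \<in> arcs_ends G" for x y
    by (auto simp: S_def parcs_mk_symmetric arcs_ends_conv)
  have S_verts: "x \<in> verts G" "y \<in> verts G" if "(x, y) \<in> S" for x y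
    using that adj_in_verts unfolding S by blast+
  have connected: "Digraph_Component.connected G \<longleftrightarrow>
      verts G \<noteq> {} \<and> (\<forall>u\<in>verts G. \<forall>v\<in>verts G. (u, v) \<in> S\<^sup>*)"
    by (simp add: connected_def strongly_connected_def S.reachable_conv S_def)
  show ?thesis
  proof
    assume "Digraph_Component.connected G"
    then have ne: "verts G \<noteq> {}" and reach: "\<And>u v. u \<in> verts G \<Longrightarrow> v \<in> verts G \<Longrightarrow> (u, v) \<in> S\<^sup>*"
      using connected by auto
    have "\<exists>x\<in>A. \<exists>y\<in>verts G - A. (x, y) \<in> arcs_ends G \<or> (y, x) \<in> arcs_ends G"
      if A: "A \<subseteq> verts G" "A \<noteq> {}" "A \<noteq> verts G" for A
    proof (rule ccontr)
      assume no: "\<not> ?thesis"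
      obtain a b where ab: "a \<in> A" "b \<in> verts G" "b \<notin> A" using A by blast
      have "(a, z) \<in> S\<^sup>* \<Longrightarrow> z \<in> A" for z
      proof (induction rule: rtrancl_induct)
        case (step y z)
        then show ?case using no S S_verts[OF step(2)] by blast
      qed (rule ab(1))
      then show False using reach[of a b] ab A by blast
    qed
    then show "linked (arcs_ends G) (verts G)" using ne by (simp add: linked_def)
  next
    assume linked: "linked (arcs_ends G) (verts G)"
    have "(u, v) \<in> S\<^sup>*" if uv: "u \<in> verts G" "v \<in> verts G" for u v
    proof (rule ccontr)
      assume "(u, v) \<notin> S\<^sup>*"
      define A where "A = {z\<in>verts G. (u, z) \<in> S\<^sup>*}"
      have "A \<subseteq> verts G" "A \<noteq> {}" "A \<noteq> verts G"
        using uv \<open>(u, v) \<notin> S\<^sup>*\<close> by (auto simp: A_def)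
      then obtain x y where xy: "x \<in> A" "y \<in> verts G" "y \<notin> A"
          "(x, y) \<in> arcs_ends G \<or> (y, x) \<in> arcs_ends G"
        using linked_cut[OF linked] by blast
      have "(u, y) \<in> S\<^sup>*"
        using xy(1,4) S rtrancl_into_rtrancl[of u x S y] by (simp add: A_def)
      then show False using xy by (simp add: A_def)
    qed
    then show "Digraph_Component.connected G" using connected linked by (simp add: linked_def)
  qed
qed

lemma arcs_ends_induce: "arcs_ends (G \<restriction> A) = Restr (arcs_ends G) A"
  by (auto simp: arcs_ends_conv)

lemma connected_induce_iff: "Digraph_Component.connected (G \<restriction> A) \<longleftrightarrow> linked (arcs_ends G) A"
proof -
  interpret GA: wf_digraph "G \<restriction> A" by (rule wellformed_induce_subgraph)
  show ?thesis using GA.connected_iff_linked by (simp add: arcs_ends_induce linked_Restr)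
qed

lemma componentsD:
  assumes "H \<in> components G"
  shows "subgraph H G" "Digraph_Component.connected H"
    "\<And>H'. subgraph H H' \<Longrightarrow> subgraph H' G \<Longrightarrow> Digraph_Component.connected H' \<Longrightarrow> H' = H"
  using assms unfolding components_def max_subgraph_def by blast+

lemma component_linked:
  assumes "H \<in> components G"
  shows "linked (arcs_ends G) (verts H)"
proof -
  have sub: "subgraph H G" using componentsD(1)[OF assms] .
  interpret H: wf_digraph H using sub by (simp add: subgraph_def)
  show ?thesis
    using componentsD(2)[OF assms] H.connected_iff_linked linked_mono arcs_ends_mono[OF sub] by blast
qed

text \<open>The subgraph induced on the vertices of \<open>H\<close> contains \<open>H\<close> and
  is connected, so maximality makes the two equal. Components can then be handled through their
  vertex sets.\<close>

lemma component_induced: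
  assumes "H \<in> components G"
  shows "G \<restriction> verts H = H" "verts H \<subseteq> verts G"
proof -
  have sub: "subgraph H G" using componentsD(1)[OF assms] .
  then show V: "verts H \<subseteq> verts G" by (simp add: subgraph_def)
  show "G \<restriction> verts H = H"
    using componentsD(3)[OF assms subgraph_induce_subgraphI2[OF sub] subgraph_induce_subgraphI[OF V]]
      component_linked[OF assms] connected_induce_iff by blast
qed

text \<open>A component enlarged by a neighbour still induces a connected subgraph, so by maximality
  the neighbour was there already.\<close>

lemma component_closed:
  assumes H: "H \<in> components G" and x: "x \<in> verts H"
    and xy: "(x, y) \<in> arcs_ends G \<or> (y, x) \<in> arcs_ends G"
  shows "y \<in> verts H"
proof -
  let ?A = "insert y (verts H)"
  have "y \<in> verts G" using xy adj_in_verts by blast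
  then have A: "?A \<subseteq> verts G" using component_induced(2)[OF H] by blast
  have "linked (arcs_ends G) ?A" using component_linked[OF H] x xy by (rule linked_insert)
  moreover have "subgraph H (G \<restriction> ?A)"
  proof -
    interpret GA: wf_digraph "G \<restriction> ?A" by (rule wellformed_induce_subgraph)
    have "subgraph ((G \<restriction> ?A) \<restriction> verts H) (G \<restriction> ?A)"
      by (rule GA.subgraph_induce_subgraphI) auto
    moreover have "(G \<restriction> ?A) \<restriction> verts H = G \<restriction> verts H" by (auto simp: induce_subgraph_def)
    ultimately show ?thesis using component_induced(1)[OF H] by simp
  qed
  ultimately have "G \<restriction> ?A = H"
    using componentsD(3)[OF H] subgraph_induce_subgraphI[OF A] connected_induce_iff by blast
  then have "verts (G \<restriction> ?A) = verts H" by (rule arg_cong)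
  then show ?thesis by auto
qed

text \<open>If \<open>H\<close> were not inside \<open>K\<close>, connectedness of \<open>H\<close>
  would give an arc leaving the common part, contrary to \<open>component_closed\<close> for
  \<open>K\<close>.\<close>

lemma component_eqI:
  assumes H: "H \<in> components G" and K: "K \<in> components G" and x: "x \<in> verts H" "x \<in> verts K"
  shows "H = K"
proof -
  have sub: "verts H \<subseteq> verts K"
    if H: "H \<in> components G" and K: "K \<in> components G" and x: "x \<in> verts H" "x \<in> verts K" for H K
  proof (rule ccontr)
    assume "\<not> verts H \<subseteq> verts K"
    then obtain u v where "u \<in> verts H \<inter> verts K" "v \<in> verts H" "v \<notin> verts H \<inter> verts K"
        "(u, v) \<in> arcs_ends G \<or> (v, u) \<in> arcs_ends G"
      using linked_cut[OF component_linked[OF H], of "verts H \<inter> verts K"] x by blast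
    then show False using component_closed[OF K] by blast
  qed
  have "verts H = verts K" using sub[OF H K x] sub[OF K H x(2,1)] by (rule subset_antisym)
  then show ?thesis using component_induced(1)[OF H] component_induced(1)[OF K] by metis
qed

end

text \<open>Finiteness gives an inclusion-maximal connected vertex set around \<open>v\<close>. Its
  induced subgraph is maximal among connected subgraphs, since a larger one has no new vertices and
  hence no new arcs.\<close>

lemma (in fin_digraph) component_exists:
  assumes v: "v \<in> verts G"
  shows "\<exists>H\<in>components G. v \<in> verts H"
proof -
  define Q where "Q = {A. A \<subseteq> verts G \<and> v \<in> A \<and> linked (arcs_ends G) A}"
  have "finite Q" by (rule finite_subset[of _ "Pow (verts G)"]) (auto simp: Q_def)
  moreover have "{v} \<in> Q" using v linked_singleton by (simp add: Q_def)
  ultimately obtain A where A: "A \<in> Q" and max: "\<And>B. B \<in> Q \<Longrightarrow> A \<subseteq> B \<Longrightarrow> A = B"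
    using finite_has_maximal[of Q] by blast
  have AV: "A \<subseteq> verts G" and vA: "v \<in> A" and lA: "linked (arcs_ends G) A"
    using A by (auto simp: Q_def)
  have "H = G \<restriction> A"
    if sub: "subgraph (G \<restriction> A) H" "subgraph H G" and conn: "Digraph_Component.connected H" for H
  proof -
    interpret H: wf_digraph H using sub(2) by (simp add: subgraph_def)
    have "linked (arcs_ends G) (verts H)"
      using conn H.connected_iff_linked linked_mono arcs_ends_mono[OF sub(2)] by blast
    moreover have AH: "A \<subseteq> verts H" "verts H \<subseteq> verts G" using sub by (auto simp: subgraph_def)
    ultimately have "A = verts H" using max[of "verts H"] vA by (auto simp: Q_def)
    then have V: "verts H = verts (G \<restriction> A)" by simp
    have th: "tail H = tail G" "head H = head G" using sub(2) by (auto simp: subgraph_def compatible_def)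
    have "arcs H \<subseteq> arcs (G \<restriction> A)"
    proof
      fix e assume e: "e \<in> arcs H"
      then have "e \<in> arcs G" using sub(2) by (auto simp: subgraph_def)
      then show "e \<in> arcs (G \<restriction> A)" using H.wellformed[OF e] V th by simp
    qed
    then have "arcs H = arcs (G \<restriction> A)" using sub(1) by (auto simp: subgraph_def)
    then show ?thesis using V th by simp
  qed
  then have "G \<restriction> A \<in> components G"
    using subgraph_induce_subgraphI[OF AV] lA connected_induce_iff
    unfolding components_def max_subgraph_def by blast
  then show ?thesis using vA by (intro bexI[of _ "G \<restriction> A"]) simp_all
qed

context acyclic_digraph
begin

lemma dag_parts_components: "dag_parts (arcs_ends G) (components G) verts"
proof unfold_locales
  \<comment> \<open>The index set consists of subgraphs; its finiteness comes from the finitely many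
    vertex sets.\<close>
  have "inj_on verts (components G)"
  proof (rule inj_onI)
    fix H K assume HK: "H \<in> components G" "K \<in> components G" "verts H = verts K"
    then show "H = K"
      using component_induced(1)[OF HK(1)] component_induced(1)[OF HK(2)] by metis
  qed
  moreover have "finite (verts ` components G)"
    by (rule finite_subset[of _ "Pow (verts G)"]) (use component_induced(2) in blast, simp)
  ultimately show "finite (components G)" by (simp add: finite_image_iff)
next
  fix H assume H: "H \<in> components G"
  show "finite (verts H)" using component_induced(2)[OF H] finite_verts by (rule finite_subset)
  show "x \<in> verts H \<longleftrightarrow> y \<in> verts H" if "(x, y) \<in> arcs_ends G" for x y
    using component_closed[OF H] that by blast
  show "verts H \<inter> verts K = {}" if "K \<in> components G" "H \<noteq> K" for K
    using component_eqI[OF H that(1)] that(2) by blast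
qed

lemma union_W_components: "dag_parts.union_W (components G) verts = verts G"
  unfolding dag_parts.union_W_def[OF dag_parts_components]
  using component_exists component_induced(2) by blast

text \<open>On the left the order and the flips are those of \<open>H\<close> alone, on the right
  those of \<open>G\<close>. They yield the same permutations by \<open>flip_perm_Restr\<close>,
  whatever extensions of \<open>H\<close> are chosen.\<close>

lemma flip_group_component:
  assumes H: "H \<in> components G" and lin: "linear_extension_pair H xs ys"
  shows "flip_group H xs ys = perm_monoid (flip_words (arcs_ends G) (verts H))"
proof -
  have E: "arcs_ends H = Restr (arcs_ends G) (verts H)"
    using arcs_ends_induce[of "verts H"] component_induced(1)[OF H] by simp
  have "digraph H" using componentsD(1)[OF H] by (rule digraph_subgraph)
  moreover have "acyclic (arcs_ends H)"
    unfolding E using acyclic_arcs by (rule acyclic_subset) blast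
  ultimately interpret H: ordered_digraph H xs ys
    using lin by (simp add: ordered_digraph_def acyclic_digraph_def acyclic_digraph_axioms_def
        ordered_digraph_axioms_def)
  have "flip_words (arcs_ends H) (verts H) = flip_words (arcs_ends G) (verts H)"
    unfolding flip_words_def E using flip_perm_Restr[OF H.finite_verts] by simp
  then show ?thesis using H.flip_group_eq by simp
qed

end

theorem theorem4p12:
  fixes G :: "('a, 'b) pre_digraph" and l l' :: "'a list"
  assumes "digraph G"
    and "acyclic (arcs_ends G)"
    and "linear_extension_pair G l l'"
  shows "(Digraph_Component.connected G \<longrightarrow>
           alternating_on (top_pairs G) \<subseteq> carrier (flip_group G l l')) \<and>
         (\<not> Digraph_Component.connected G \<longrightarrow>
           (\<forall>ls ls'. (\<forall>H \<in> components G. linear_extension_pair H (ls H) (ls' H)) \<longrightarrow>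
             flip_group G l l' \<cong>
               product_group (components G) (\<lambda>H. flip_group H (ls H) (ls' H))))"
proof -
  interpret ordered_digraph G l l'
    using assms by (simp add: ordered_digraph_def acyclic_digraph_def acyclic_digraph_axioms_def
        ordered_digraph_axioms_def)
  have alt: "alternating_on (top_pairs G) \<subseteq> carrier (flip_group G l l')"
    if "Digraph_Component.connected G"
  proof -
    have "has_3cycles E V"
      using has_3cycles_linked[OF dag_axioms finite_verts arcs_in_verts] that connected_iff_linked by simp
    then have "alternating_on (tpairs E V) \<subseteq> flip_words E V"
      by (intro perm_closed.alternating_on_subset perm_closed_flip_words finite_tpairs finite_verts)
        (auto simp: has_3cycles_def)
    then show ?thesis by (simp add: flip_group_eq top_pairs_eq)
  qed
  have prod: "flip_group G l l' \<cong> product_group (components G) (\<lambda>H. flip_group H (ls H) (ls' H))"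
    if lin: "\<forall>H \<in> components G. linear_extension_pair H (ls H) (ls' H)" for ls ls'
  proof -
    have "product_group (components G) (\<lambda>H. flip_group H (ls H) (ls' H))
        = product_group (components G) (\<lambda>H. perm_monoid (flip_words E (verts H)))"
      using lin flip_group_component
      by (simp add: product_group_def cong: PiE_cong restrict_cong)
    then show ?thesis
      using dag_parts.flip_words_product[OF dag_parts_components]
      by (simp add: flip_group_eq union_W_components)
  qed
  show ?thesis using alt prod by blast
qed

end
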